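(* Let $\Lambda$ be the weight lattice of a semisimple root system with Weyl group $W$ and fundamental weights $\omega_1,\ldots,\omega_n$ (a $\mathbb{Z}$-basis of $\Lambda$), and let $T^*\subset\Lambda$ be a subgroup of index $2$ (the character lattice of a split maximal torus of the corresponding group $G$). Use the notation $n'$, $s_j$, $d_i$, $d$, $a_{i,j}$, $\rho(\omega_i)$, $\rho_i$, $\tilde\rho_i$, $\tilde\rho(\omega_i)$, $\lambda_0$, $r_i$, $h_{1,i},h_{2,i},h_{3,i}$ and $I^W_{sc}$ described in the context. Assume that the $n$-tuple $(\rho_1,\ldots,\rho_n)$ satisfies the generalized flatness condition (over $R=\mathbb{Z}$) with respect to some $\mathbb{Z}$-basis $\{x_1,\ldots,x_n\}$ of $\Lambda$. Then the elements $$h_{1,i}\ (1\le i<n'),\qquad h_{2,i}\ (1\le i\le n'),\qquad h_{3,i}\ (n'<i\le n)$$ generate the ideal $I^W_{sc}\cap\mathbb{Z}[T^*]$ of the ring $\mathbb{Z}[T^*]$.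
   Context: For a ring $R$ (here $R=\mathbb{Z}$ or $\mathbb{Z}/m\mathbb{Z}$, $m\ge 2$) and a free abelian group $\Lambda$ with basis $x_1,\ldots,x_n$, $R[\Lambda]$ is the group ring, identified with the Laurent polynomial ring $R[x_1^{\pm1},\ldots,x_n^{\pm1}]$; $\Lambda_i$ denotes the subgroup spanned by $x_1,\ldots,x_i$. A polynomial $p\in R[\Lambda_i]$ is a divisor with respect to $x_i$ if, writing $p=p_kx_i^k+\cdots+p_mx_i^m$ with $p_j\in R[\Lambda_{i-1}]$, $p_k\neq0$, the leading coefficient $p_k$ is a monic monomial in $x_1,\ldots,x_{i-1}$ (coefficient $1$). An $n$-tuple $(q_1,\ldots,q_n)$ satisfies the flatness condition if $q_i\in R[\Lambda_i]$ and $q_i$ is a divisor with respect to $x_i$ for each $i$; it satisfies the generalized flatness condition if there is $A\in GL_n(R[\Lambda])$ such that $(q_1,\ldots,q_n)A$ satisfies the flatness condition. Grading: each $\lambda\in\Lambda$ has degree $|\lambda|\in\Lambda/T^*=\mathbb{Z}/2\mathbb{Z}$; $\Lambda^{(0)}=T^*$, $\Lambda^{(1)}=\Lambda\setminus T^*$. After reindexing, $\omega_1,\ldots,\omega_{n'}\notin T^*$ and $\omega_{n'+1},\ldots,\omega_n\in T^*$. Put $s_j=|W(\omega_j)|$ (size of the $W$-orbit), $\rho(\omega_j)=\sum_{\lambda\in W(\omega_j)}e^{\lambda}\in\mathbb{Z}[\Lambda]$, $\rho_j=\rho(\omega_j)-s_j$. For $1\le i\le n'$ let $d_i=\gcd(s_i,s_{i+1},\ldots,s_{n'})$,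 $d=d_1$, and fix integers $a_{i,j}$ ($i\le j\le n'$) with $d_i=\sum_{j=i}^{n'}a_{i,j}s_j$; set $\tilde\rho_i=\sum_{j=i}^{n'}a_{i,j}\rho_j$ and $\tilde\rho(\omega_i)=\tilde\rho_i+d_i$. Fix $\lambda_0\in\Lambda^{(1)}$. Define, for $1\le i<n'$ with $r_i=\operatorname{lcm}(s_i,d_{i+1})$, $h_{1,i}=e^{\lambda_0}\big(\tfrac{r_i}{s_i}\rho(\omega_i)-\tfrac{r_i}{d_{i+1}}\tilde\rho(\omega_{i+1})\big)$; for $1\le i\le n'$, $h_{2,i}=\rho(\omega_i)\tilde\rho(\omega_1)-d s_i$; for $n'<i\le n$, $h_{3,i}=\rho_i$. These lie in $\mathbb{Z}[T^*]$. $I^W_{sc}$ is the ideal of $\mathbb{Z}[\Lambda]$ generated by the $W$-invariant elements of the augmentation ideal (kernel of $\mathbb{Z}[\Lambda]\to\mathbb{Z}$, $e^\lambda\mapsto1$). *)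

theory Defs
  imports "HOL-Analysis.Analysis" "HOL-Library.Poly_Mapping"
begin

definition refl_root :: "real^('n::finite) \<Rightarrow> real^('n::finite) \<Rightarrow> real^('n::finite)" where
  "refl_root a v = v - ((2 * (v \<bullet> a)) / (a \<bullet> a)) *\<^sub>R a"

text \<open>A (reduced, crystallographic) root system spanning the ambient space;
  "semisimple" means the roots span the whole space.\<close>
definition root_system :: "(real^('n::finite)) set \<Rightarrow> bool" where
  "root_system Phi \<longleftrightarrow> finite Phi \<and> 0 \<notin> Phi \<and> span Phi = UNIV
     \<and> (\<forall>a\<in>Phi. refl_root a ` Phi = Phi)
     \<and> (\<forall>a\<in>Phi. \<forall>b\<in>Phi. (2 * (b \<bullet> a)) / (a \<bullet> a) \<in> \<int>)
     \<and> (\<forall>a\<in>Phi. \<forall>c::real. c *\<^sub>R a \<in> Phi \<longrightarrow> c = 1 \<or> c = -1)"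

definition is_base :: "(real^('n::finite)) set \<Rightarrow> nat \<Rightarrow> (nat \<Rightarrow> real^('n::finite)) \<Rightarrow> bool" where
  "is_base Phi n al \<longleftrightarrow> inj_on al {1..n} \<and> al ` {1..n} \<subseteq> Phi
     \<and> independent (al ` {1..n}) \<and> span (al ` {1..n}) = UNIV
     \<and> (\<forall>b\<in>Phi. \<exists>c::nat \<Rightarrow> int.
          b = (\<Sum>i=1..n. of_int (c i) *\<^sub>R al i)
          \<and> ((\<forall>i\<in>{1..n}. c i \<ge> 0) \<or> (\<forall>i\<in>{1..n}. c i \<le> 0)))"

definition weight_lattice :: "(real^('n::finite)) set \<Rightarrow> (real^('n::finite)) set" where
  "weight_lattice Phi = {l. \<forall>b\<in>Phi. (2 * (l \<bullet> b)) / (b \<bullet> b) \<in> \<int>}"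

definition fundamental_weights ::
    "nat \<Rightarrow> (nat \<Rightarrow> real^('n::finite)) \<Rightarrow> (nat \<Rightarrow> real^('n::finite)) \<Rightarrow> bool" where
  "fundamental_weights n al om \<longleftrightarrow>
     (\<forall>i\<in>{1..n}. \<forall>j\<in>{1..n}.
        (2 * (om i \<bullet> al j)) / (al j \<bullet> al j) = (if i = j then 1 else 0))"

inductive_set weyl_group :: "(real^('n::finite)) set \<Rightarrow> (real^('n::finite) \<Rightarrow> real^('n::finite)) set"
  for Phi where
  id: "id \<in> weyl_group Phi"
| step: "w \<in> weyl_group Phi \<Longrightarrow> a \<in> Phi \<Longrightarrow> refl_root a \<circ> w \<in> weyl_group Phi"

definition orbit :: "(real^('n::finite)) set \<Rightarrow> real^('n::finite) \<Rightarrow> (real^('n::finite)) set" where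
  "orbit Phi l = {w l | w. w \<in> weyl_group Phi}"

type_synonym 'n grp_ring = "real^'n \<Rightarrow>\<^sub>0 int"

abbreviation ex :: "real^('n::finite) \<Rightarrow> 'n grp_ring" where
  "ex l \<equiv> Poly_Mapping.single l 1"

definition group_ring_on :: "(real^('n::finite)) set \<Rightarrow> 'n grp_ring set" where
  "group_ring_on L = {p. Poly_Mapping.keys p \<subseteq> L}"

definition W_invariant :: "(real^('n::finite)) set \<Rightarrow> 'n grp_ring \<Rightarrow> bool" where
  "W_invariant Phi p \<longleftrightarrow> (\<forall>w\<in>weyl_group Phi. \<forall>l. Poly_Mapping.lookup p (w l) = Poly_Mapping.lookup p l)"

definition augmentation :: "'n grp_ring \<Rightarrow> int" where
  "augmentation p = (\<Sum>l\<in>Poly_Mapping.keys p. Poly_Mapping.lookup p l)"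

definition ideal_span :: "'a::comm_ring_1 set \<Rightarrow> 'a set \<Rightarrow> 'a set" where
  "ideal_span R G = {(\<Sum>g\<in>F. c g * g) | F c. finite F \<and> F \<subseteq> G \<and> (\<forall>g\<in>F. c g \<in> R)}"

definition I_sc :: "(real^('n::finite)) set \<Rightarrow> 'n grp_ring set" where
  "I_sc Phi = ideal_span (group_ring_on (weight_lattice Phi))
     {p \<in> group_ring_on (weight_lattice Phi). W_invariant Phi p \<and> augmentation p = 0}"

definition rho :: "(real^('n::finite)) set \<Rightarrow> real^('n::finite) \<Rightarrow> 'n grp_ring" where
  "rho Phi l = (\<Sum>m\<in>orbit Phi l. ex m)"

definition index2_subgroup :: "(real^('n::finite)) set \<Rightarrow> (real^('n::finite)) set \<Rightarrow> bool" where
  "index2_subgroup T L \<longleftrightarrow> T \<subseteq> L \<and> 0 \<in> T \<and> (\<forall>a\<in>T. \<forall>b\<in>T. a + b \<in> T \<and> - a \<in> T)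
     \<and> card {(+) l ` T | l. l \<in> L} = 2"

definition int_span :: "nat \<Rightarrow> (nat \<Rightarrow> real^('n::finite)) \<Rightarrow> (real^('n::finite)) set" where
  "int_span k x = {(\<Sum>i=1..k. of_int (c i) *\<^sub>R x i) | c. True}"

definition is_Z_basis :: "(real^('n::finite)) set \<Rightarrow> nat \<Rightarrow> (nat \<Rightarrow> real^('n::finite)) \<Rightarrow> bool" where
  "is_Z_basis L n x \<longleftrightarrow> int_span n x = L
     \<and> (\<forall>c::nat \<Rightarrow> int. (\<Sum>i=1..n. of_int (c i) *\<^sub>R x i) = 0 \<longrightarrow> (\<forall>i\<in>{1..n}. c i = 0))"

text \<open>p in Z[Lambda_i] is a divisor w.r.t. x_i: writing p = sum_j p_j x_i^j with
  p_j in Z[Lambda_(i-1)], the coefficient p_k of the lowest occurring power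
  is a monic monomial e^mu, mu in Lambda_(i-1).\<close>
definition divisor_wrt :: "(nat \<Rightarrow> real^('n::finite)) \<Rightarrow> nat \<Rightarrow> 'n grp_ring \<Rightarrow> bool" where
  "divisor_wrt x i p \<longleftrightarrow> p \<noteq> 0 \<and>
     (let E = {j::int. \<exists>m\<in>int_span (i - 1) x. Poly_Mapping.lookup p (m + of_int j *\<^sub>R x i) \<noteq> 0};
          k = Min E
      in \<exists>mu\<in>int_span (i - 1) x. \<forall>m\<in>int_span (i - 1) x.
           Poly_Mapping.lookup p (m + of_int k *\<^sub>R x i) = (if m = mu then 1 else 0))"

definition flat :: "nat \<Rightarrow> (nat \<Rightarrow> real^('n::finite)) \<Rightarrow> (nat \<Rightarrow> 'n grp_ring) \<Rightarrow> bool" where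
  "flat n x q \<longleftrightarrow> (\<forall>i\<in>{1..n}. q i \<in> group_ring_on (int_span i x) \<and> divisor_wrt x i (q i))"

definition invertible_over ::
    "('n::finite) grp_ring set \<Rightarrow> nat \<Rightarrow> (nat \<Rightarrow> nat \<Rightarrow> 'n grp_ring) \<Rightarrow> bool" where
  "invertible_over R n A \<longleftrightarrow> (\<forall>i\<in>{1..n}. \<forall>j\<in>{1..n}. A i j \<in> R) \<and>
     (\<exists>B. (\<forall>i\<in>{1..n}. \<forall>j\<in>{1..n}. B i j \<in> R) \<and>
          (\<forall>i\<in>{1..n}. \<forall>j\<in>{1..n}.
             (\<Sum>k=1..n. A i k * B k j) = (if i = j then 1 else 0) \<and>
             (\<Sum>k=1..n. B i k * A k j) = (if i = j then 1 else 0)))"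

definition gen_flat :: "(real^('n::finite)) set \<Rightarrow> nat \<Rightarrow> (nat \<Rightarrow> real^('n::finite)) \<Rightarrow> (nat \<Rightarrow> 'n grp_ring) \<Rightarrow> bool" where
  "gen_flat L n x q \<longleftrightarrow> (\<exists>A. invertible_over (group_ring_on L) n A \<and>
      flat n x (\<lambda>j. \<Sum>i=1..n. q i * A i j))"


definition s_orb :: "(real^('n::finite)) set \<Rightarrow> (nat \<Rightarrow> real^('n::finite)) \<Rightarrow> nat \<Rightarrow> int" where
  "s_orb Phi om j = int (card (orbit Phi (om j)))"

definition d_gcd :: "(real^('n::finite)) set \<Rightarrow> (nat \<Rightarrow> real^('n::finite)) \<Rightarrow> nat \<Rightarrow> nat \<Rightarrow> int" where
  "d_gcd Phi om np i = Gcd (s_orb Phi om ` {i..np})"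

definition rho_j :: "(real^('n::finite)) set \<Rightarrow> (nat \<Rightarrow> real^('n::finite)) \<Rightarrow> nat \<Rightarrow> 'n grp_ring" where
  "rho_j Phi om j = rho Phi (om j) - of_int (s_orb Phi om j)"

definition rho_tilde_om ::
    "(real^('n::finite)) set \<Rightarrow> (nat \<Rightarrow> real^('n::finite)) \<Rightarrow> nat \<Rightarrow> (nat \<Rightarrow> nat \<Rightarrow> int) \<Rightarrow> nat \<Rightarrow> 'n grp_ring" where
  "rho_tilde_om Phi om np a i =
     (\<Sum>j=i..np. of_int (a i j) * rho_j Phi om j) + of_int (d_gcd Phi om np i)"

definition h1 :: "(real^('n::finite)) set \<Rightarrow> (nat \<Rightarrow> real^('n::finite)) \<Rightarrow> nat \<Rightarrow> (nat \<Rightarrow> nat \<Rightarrow> int)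
    \<Rightarrow> real^('n::finite) \<Rightarrow> nat \<Rightarrow> 'n grp_ring" where
  "h1 Phi om np a l0 i =
     (let r = lcm (s_orb Phi om i) (d_gcd Phi om np (i + 1)) in
      ex l0 * (of_int (r div s_orb Phi om i) * rho Phi (om i)
               - of_int (r div d_gcd Phi om np (i + 1)) * rho_tilde_om Phi om np a (i + 1)))"

definition h2 :: "(real^('n::finite)) set \<Rightarrow> (nat \<Rightarrow> real^('n::finite)) \<Rightarrow> nat \<Rightarrow> (nat \<Rightarrow> nat \<Rightarrow> int)
    \<Rightarrow> nat \<Rightarrow> 'n grp_ring" where
  "h2 Phi om np a i = rho Phi (om i) * rho_tilde_om Phi om np a 1
      - of_int (d_gcd Phi om np 1 * s_orb Phi om i)"

definition h3 :: "(real^('n::finite)) set \<Rightarrow> (nat \<Rightarrow> real^('n::finite)) \<Rightarrow> nat \<Rightarrow> 'n grp_ring" where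
  "h3 Phi om i = rho_j Phi om i"

end

theory Submission
  imports Defs
begin

text \<open>
  Write \<open>q i = rho i\<close>, \<open>Y = rho-tilde 1\<close>, \<open>y = Y + d\<close> and \<open>z i = q i - (s i / d) * Y\<close>, with \<open>s i / d\<close>
  replaced by \<open>0\<close> for \<open>i > n'\<close>. By Chevalley's theorem \<open>I_sc\<close> is generated by the \<open>q i\<close>, hence by
  \<open>J = (z 1, ..., z n, y\<^sup>2 - d\<^sup>2)\<close> together with \<open>y - d\<close>, and the \<open>h\<close> generate the even part of \<open>J\<close>.
  If \<open>f = j + g * (y - d)\<close> is even, comparing odd parts gives \<open>d * (g1 * y - d * g0) \<in> J\<close>, so that
  everything reduces to the quotient by \<open>J\<close> having no \<open>d\<close>-torsion. Generalized flatness makes the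
  first Koszul homology of the \<open>q i\<close> modulo \<open>d\<close> vanish; since \<open>y\<^sup>2 - d\<^sup>2\<close> is congruent to \<open>Y\<^sup>2\<close>
  modulo \<open>d\<close>, two applications of this vanishing show that a syzygy of the generators of \<open>J\<close> modulo
  \<open>d\<close> is Koszul, and Koszul syzygies lift to the integers.
\<close>

section \<open>Koszul syzygies\<close>

text \<open>The obstacle is that \<open>y - d\<close> is not homogeneous for the Z/2-grading,
  whereas \<open>z 1, ..., z n\<close> and \<open>y\<^sup>2 - d\<^sup>2\<close> are. This is the
  reason for \<open>J\<close>, whose even part can be read off generator by generator. Vanishing of
  the first Koszul homology is used instead of regularity because it survives an invertible change
  of generators, which is exactly the freedom that generalized flatness allows. Passing to the
  quotient modulo \<open>d\<close> does no harm to flatness, since a leading coefficient 1 stays a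
  unit there. The Bezout coefficients \<open>a i\<close> of \<open>d\<close> make the
  \<open>z i\<close> satisfy \<open>\<Sum>i. a i * z i = 0\<close>. To trade the \<open>q i\<close>
  for \<open>Y\<close> and \<open>n - 1\<close> further generators, one would have to complete the
  vector of the \<open>a i\<close> to an invertible matrix; keeping all \<open>n\<close> of the
  \<open>z i\<close> together with this relation avoids that. Koszul syzygies lift because their
  matrix is required to be antisymmetric over the ring itself and not merely modulo
  \<open>d\<close>.\<close>

locale csubring =
  fixes R :: "'a::comm_ring_1 set"
  assumes zero_mem [simp, intro]: "0 \<in> R" and one_mem [simp, intro]: "1 \<in> R"
    and add_mem [simp, intro]: "u \<in> R \<Longrightarrow> v \<in> R \<Longrightarrow> u + v \<in> R"
    and mult_mem [simp, intro]: "u \<in> R \<Longrightarrow> v \<in> R \<Longrightarrow> u * v \<in> R"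
    and uminus_mem [simp, intro]: "u \<in> R \<Longrightarrow> - u \<in> R"
begin

lemma diff_mem [simp, intro]: "u \<in> R \<Longrightarrow> v \<in> R \<Longrightarrow> u - v \<in> R"
  using add_mem[of u "- v"] by simp

lemma sum_mem [intro]: "(\<And>i. i \<in> I \<Longrightarrow> f i \<in> R) \<Longrightarrow> sum f I \<in> R"
  by (induction I rule: infinite_finite_induct) auto

lemma of_nat_mem [simp, intro]: "of_nat k \<in> R"
  by (induction k) auto

lemma of_int_mem [simp, intro]: "of_int k \<in> R"
  by (cases k rule: int_diff_cases) simp

section \<open>Ideals of a subring\<close>

definition ideal :: "'a set \<Rightarrow> bool" where
  "ideal J \<longleftrightarrow> 0 \<in> J \<and> (\<forall>u\<in>J. \<forall>v\<in>J. u + v \<in> J) \<and> (\<forall>r\<in>R. \<forall>u\<in>J. r * u \<in> J)"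

lemma ideal_zero: "ideal J \<Longrightarrow> 0 \<in> J"
  and ideal_add: "ideal J \<Longrightarrow> u \<in> J \<Longrightarrow> v \<in> J \<Longrightarrow> u + v \<in> J"
  and ideal_mult: "ideal J \<Longrightarrow> r \<in> R \<Longrightarrow> u \<in> J \<Longrightarrow> r * u \<in> J"
  by (auto simp: ideal_def)

lemma ideal_uminus: "ideal J \<Longrightarrow> u \<in> J \<Longrightarrow> - u \<in> J"
  using ideal_mult[of J "-1" u] by simp

lemma ideal_diff: "ideal J \<Longrightarrow> u \<in> J \<Longrightarrow> v \<in> J \<Longrightarrow> u - v \<in> J"
  using ideal_add[of J u "- v"] ideal_uminus[of J v] by simp

lemma ideal_sum: "ideal J \<Longrightarrow> (\<And>i. i \<in> I \<Longrightarrow> f i \<in> J) \<Longrightarrow> sum f I \<in> J"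
  by (induction I rule: infinite_finite_induct) (auto simp: ideal_zero ideal_add)

lemma ideal_span_subset:
  assumes "ideal J" "G \<subseteq> J"
  shows "ideal_span R G \<subseteq> J"
  using assms unfolding ideal_span_def by (blast intro: ideal_sum ideal_mult)

lemma ideal_span_superset: "G \<subseteq> ideal_span R G"
proof
  fix g assume "g \<in> G"
  then show "g \<in> ideal_span R G"
    unfolding ideal_span_def by (intro CollectI exI[of _ "{g}"] exI[of _ "\<lambda>_. 1"]) auto
qed

lemma ideal_ideal_span: "ideal (ideal_span R G)"
  unfolding ideal_def
proof (intro conjI ballI)
  show "0 \<in> ideal_span R G"
    unfolding ideal_span_def by (intro CollectI exI[of _ "{}"]) auto
next
  fix u v assume "u \<in> ideal_span R G" "v \<in> ideal_span R G"
  then obtain F c F' c' where F: "finite F" "F \<subseteq> G" "\<forall>g\<in>F. c g \<in> R" "u = (\<Sum>g\<in>F. c g * g)"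
    and F': "finite F'" "F' \<subseteq> G" "\<forall>g\<in>F'. c' g \<in> R" "v = (\<Sum>g\<in>F'. c' g * g)"
    unfolding ideal_span_def by blast
  define e where "e g = (if g \<in> F then c g else 0) + (if g \<in> F' then c' g else 0)" for g
  have "u = (\<Sum>g\<in>F \<union> F'. (if g \<in> F then c g else 0) * g)"
    unfolding F(4) using F(1) F'(1) by (intro sum.mono_neutral_cong_left) auto
  moreover have "v = (\<Sum>g\<in>F \<union> F'. (if g \<in> F' then c' g else 0) * g)"
    unfolding F'(4) using F(1) F'(1) by (intro sum.mono_neutral_cong_left) auto
  ultimately have "u + v = (\<Sum>g\<in>F \<union> F'. e g * g)"
    by (simp add: e_def distrib_right sum.distrib)
  moreover have "\<forall>g\<in>F \<union> F'. e g \<in> R"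
    using F(3) F'(3) by (auto simp: e_def)
  ultimately show "u + v \<in> ideal_span R G"
    unfolding ideal_span_def using F F' by (intro CollectI exI[of _ "F \<union> F'"] exI[of _ e]) auto
next
  fix r u assume r: "r \<in> R" and "u \<in> ideal_span R G"
  then obtain F c where F: "finite F" "F \<subseteq> G" "\<forall>g\<in>F. c g \<in> R" "u = (\<Sum>g\<in>F. c g * g)"
    unfolding ideal_span_def by blast
  then show "r * u \<in> ideal_span R G"
    unfolding ideal_span_def using r
    by (intro CollectI exI[of _ F] exI[of _ "\<lambda>g. r * c g"]) (auto simp: sum_distrib_left mult.assoc)
qed

text \<open>Every syzygy of \<open>q\<close> modulo \<open>D\<close> is a Koszul syzygy modulo \<open>D\<close>, i.e. the first Koszul homology
  of \<open>q\<close> over \<open>R / D R\<close> vanishes.\<close>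
definition koszul_mod :: "'a \<Rightarrow> nat set \<Rightarrow> (nat \<Rightarrow> 'a) \<Rightarrow> bool" where
  "koszul_mod D I q \<longleftrightarrow> (\<forall>c u. (\<forall>i\<in>I. c i \<in> R) \<longrightarrow> u \<in> R \<longrightarrow> (\<Sum>i\<in>I. c i * q i) = D * u \<longrightarrow>
     (\<exists>K e. (\<forall>i\<in>I. \<forall>j\<in>I. K i j \<in> R \<and> K i j = - K j i) \<and>
            (\<forall>i\<in>I. e i \<in> R \<and> c i = (\<Sum>j\<in>I. K i j * q j) + D * e i)))"

lemma koszul_modE:
  assumes "koszul_mod D I q" "\<And>i. i \<in> I \<Longrightarrow> c i \<in> R" "u \<in> R" "(\<Sum>i\<in>I. c i * q i) = D * u"
  obtains K e where "\<forall>i\<in>I. \<forall>j\<in>I. K i j \<in> R \<and> K i j = - K j i"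
    "\<forall>i\<in>I. e i \<in> R \<and> c i = (\<Sum>j\<in>I. K i j * q j) + D * e i"
  using assms(1)[unfolded koszul_mod_def, rule_format, of c u] assms(2-4) by blast

text \<open>The vector \<open>b = B c\<close> solves \<open>A b = c\<close> and is therefore a
  syzygy of the transformed tuple \<open>p = q A\<close>. If \<open>L\<close> is an antisymmetric
  matrix for \<open>b\<close>, then \<open>M = A L A^T\<close> is one for \<open>c\<close>.\<close>

lemma koszul_mod_transform:
  assumes fin: "finite I" and K: "koszul_mod D I (\<lambda>j. \<Sum>i\<in>I. q i * A i j)"
    and A: "\<And>i j. i \<in> I \<Longrightarrow> j \<in> I \<Longrightarrow> A i j \<in> R" and B: "\<And>i j. i \<in> I \<Longrightarrow> j \<in> I \<Longrightarrow> B i j \<in> R"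
    and AB: "\<And>i j. i \<in> I \<Longrightarrow> j \<in> I \<Longrightarrow> (\<Sum>k\<in>I. A i k * B k j) = (if i = j then 1 else 0)"
  shows "koszul_mod D I q"
  unfolding koszul_mod_def
proof (intro allI impI)
  fix c u assume c: "\<forall>i\<in>I. c i \<in> R" and u: "u \<in> R" and eq: "(\<Sum>i\<in>I. c i * q i) = D * u"
  define p where "p j = (\<Sum>i\<in>I. q i * A i j)" for j
  define b where "b k = (\<Sum>j\<in>I. B k j * c j)" for k
  have b: "b k \<in> R" if "k \<in> I" for k
    unfolding b_def using that c B by (intro sum_mem mult_mem) auto
  have Ab: "(\<Sum>k\<in>I. A i k * b k) = c i" if i: "i \<in> I" for i
  proof -
    have "(\<Sum>k\<in>I. A i k * b k) = (\<Sum>j\<in>I. \<Sum>k\<in>I. A i k * B k j * c j)"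
      unfolding b_def sum_distrib_left by (subst sum.swap) (simp add: mult.assoc)
    also have "\<dots> = (\<Sum>j\<in>I. (if i = j then 1 else 0) * c j)"
      using AB i by (intro sum.cong refl) (simp flip: sum_distrib_right)
    also have "\<dots> = c i" using fin i by (simp add: if_distrib[where f="\<lambda>x. x * _"] cong: if_cong)
    finally show ?thesis .
  qed
  have "(\<Sum>k\<in>I. b k * p k) = (\<Sum>i\<in>I. \<Sum>k\<in>I. b k * (q i * A i k))"
    unfolding p_def sum_distrib_left by (rule sum.swap)
  also have "\<dots> = (\<Sum>i\<in>I. (\<Sum>k\<in>I. A i k * b k) * q i)"
    by (intro sum.cong refl) (simp add: sum_distrib_left sum_distrib_right algebra_simps)
  also have "\<dots> = D * u" using Ab eq by simp
  finally have bp: "(\<Sum>k\<in>I. b k * p k) = D * u" .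
  obtain L e where L0: "\<forall>i\<in>I. \<forall>j\<in>I. L i j \<in> R \<and> L i j = - L j i"
    and e0: "\<forall>i\<in>I. e i \<in> R \<and> b i = (\<Sum>j\<in>I. L i j * p j) + D * e i"
    by (rule koszul_modE[OF K[folded p_def], of b, OF b u bp])
  have L: "L i j \<in> R" "L i j = - L j i" if "i \<in> I" "j \<in> I" for i j using L0 that by blast+
  have e: "e i \<in> R" and be: "b i = (\<Sum>j\<in>I. L i j * p j) + D * e i" if "i \<in> I" for i
    using e0 that by blast+
  define M where "M i j = (\<Sum>k\<in>I. \<Sum>l\<in>I. A i k * L k l * A j l)" for i j
  define f where "f i = (\<Sum>k\<in>I. A i k * e k)" for i
  have M: "M i j \<in> R" if "i \<in> I" "j \<in> I" for i j
    unfolding M_def using that A L(1) by (intro sum_mem mult_mem) auto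
  have M': "M i j = - M j i" if "i \<in> I" "j \<in> I" for i j
  proof -
    have "M i j = (\<Sum>l\<in>I. \<Sum>k\<in>I. A i k * L k l * A j l)" unfolding M_def by (rule sum.swap)
    also have "\<dots> = (\<Sum>l\<in>I. \<Sum>k\<in>I. - (A j l * L l k * A i k))"
    proof (intro sum.cong refl)
      fix l k assume "l \<in> I" "k \<in> I"
      then have "L k l = - L l k" by (rule L(2)[rotated])
      then show "A i k * L k l * A j l = - (A j l * L l k * A i k)" by (simp add: algebra_simps)
    qed
    also have "\<dots> = - M j i" unfolding M_def by (simp add: sum_negf)
    finally show ?thesis .
  qed
  have f: "f i \<in> R" if "i \<in> I" for i
    unfolding f_def using that A e by (intro sum_mem mult_mem) auto
  have "c i = (\<Sum>j\<in>I. M i j * q j) + D * f i" if i: "i \<in> I" for i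
  proof -
    have "c i = (\<Sum>k\<in>I. A i k * ((\<Sum>j\<in>I. L k j * p j) + D * e k))"
      using Ab[OF i] be by simp
    also have "\<dots> = (\<Sum>k\<in>I. \<Sum>l\<in>I. A i k * L k l * p l) + D * f i"
      unfolding f_def by (simp add: sum_distrib_left sum.distrib algebra_simps)
    also have "(\<Sum>k\<in>I. \<Sum>l\<in>I. A i k * L k l * p l) = (\<Sum>k\<in>I. \<Sum>l\<in>I. \<Sum>j\<in>I. A i k * L k l * A j l * q j)"
      unfolding p_def by (simp add: sum_distrib_left algebra_simps)
    also have "\<dots> = (\<Sum>k\<in>I. \<Sum>j\<in>I. \<Sum>l\<in>I. A i k * L k l * A j l * q j)"
      by (intro sum.cong refl sum.swap)
    also have "\<dots> = (\<Sum>j\<in>I. \<Sum>k\<in>I. \<Sum>l\<in>I. A i k * L k l * A j l * q j)"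
      by (rule sum.swap)
    also have "\<dots> = (\<Sum>j\<in>I. M i j * q j)"
      unfolding M_def by (simp add: sum_distrib_right)
    finally show ?thesis .
  qed
  with M M' f show "\<exists>K e. (\<forall>i\<in>I. \<forall>j\<in>I. K i j \<in> R \<and> K i j = - K j i) \<and>
            (\<forall>i\<in>I. e i \<in> R \<and> c i = (\<Sum>j\<in>I. K i j * q j) + D * e i)"
    by (intro exI[of _ M] exI[of _ f] conjI ballI)
qed

definition partial_ideal :: "'a \<Rightarrow> (nat \<Rightarrow> 'a) \<Rightarrow> nat \<Rightarrow> 'a set" where
  "partial_ideal D p k = {(\<Sum>i=1..k. c i * p i) + D * v | c v. (\<forall>i\<in>{1..k}. c i \<in> R) \<and> v \<in> R}"

lemma ideal_partial_ideal: "ideal (partial_ideal D p k)"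
  unfolding ideal_def
proof (intro conjI ballI)
  show "0 \<in> partial_ideal D p k"
    unfolding partial_ideal_def by (intro CollectI exI[of _ "\<lambda>_. 0"] exI[of _ 0]) auto
next
  fix u v assume "u \<in> partial_ideal D p k" "v \<in> partial_ideal D p k"
  then obtain c a c' a' where "u = (\<Sum>i=1..k. c i * p i) + D * a" "v = (\<Sum>i=1..k. c' i * p i) + D * a'"
    "\<forall>i\<in>{1..k}. c i \<in> R" "\<forall>i\<in>{1..k}. c' i \<in> R" "a \<in> R" "a' \<in> R"
    unfolding partial_ideal_def by blast
  then show "u + v \<in> partial_ideal D p k"
    unfolding partial_ideal_def
    by (intro CollectI exI[of _ "\<lambda>i. c i + c' i"] exI[of _ "a + a'"]) (auto simp: algebra_simps sum.distrib)
next
  fix r u assume "r \<in> R" "u \<in> partial_ideal D p k"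
  then obtain c a where "u = (\<Sum>i=1..k. c i * p i) + D * a" "r \<in> R"
    "\<forall>i\<in>{1..k}. c i \<in> R" "a \<in> R"
    unfolding partial_ideal_def by blast
  then show "r * u \<in> partial_ideal D p k"
    unfolding partial_ideal_def
    by (intro CollectI exI[of _ "\<lambda>i. r * c i"] exI[of _ "r * a"]) (auto simp: algebra_simps sum_distrib_left)
qed

text \<open>Regularity writes the last coefficient \<open>c (Suc n)\<close> as
  \<open>\<Sum>i. b i * p i + D * v\<close>. Subtracting the Koszul syzygies between
  \<open>p i\<close> and \<open>p (Suc n)\<close>, weighted by \<open>b i\<close>, leaves a syzygy
  of the first \<open>n\<close> entries modulo \<open>D\<close>, to which the induction hypothesis
  applies.\<close>

lemma koszul_mod_regular:
  assumes "\<And>k c. k \<in> {1..n} \<Longrightarrow> c \<in> R \<Longrightarrow> p k * c \<in> partial_ideal D p (k - 1) \<Longrightarrow> c \<in> partial_ideal D p (k - 1)"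
    and "\<And>k. k \<in> {1..n} \<Longrightarrow> p k \<in> R" and D: "\<And>u. D * u = 0 \<Longrightarrow> u = 0"
  shows "koszul_mod D {1..n} p"
  using assms(1,2)
proof (induction n)
  case 0
  show ?case unfolding koszul_mod_def by auto
next
  case (Suc n)
  have IH: "koszul_mod D {1..n} p" using Suc by simp
  have pR: "p i \<in> R" if "i \<in> {1..Suc n}" for i using Suc.prems(2) that by simp
  show ?case
    unfolding koszul_mod_def
  proof (intro allI impI)
    fix c u assume c: "\<forall>i\<in>{1..Suc n}. c i \<in> R" and u: "u \<in> R"
      and eq: "(\<Sum>i=1..Suc n. c i * p i) = D * u"
    have "p (Suc n) * c (Suc n) = (\<Sum>i=1..n. - c i * p i) + D * u"
      using eq by (simp add: sum_negf algebra_simps)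
    then have "p (Suc n) * c (Suc n) \<in> partial_ideal D p n"
      unfolding partial_ideal_def using c u
      by (intro CollectI exI[of _ "\<lambda>i. - c i"] exI[of _ u]) auto
    then have "c (Suc n) \<in> partial_ideal D p n"
      using Suc.prems(1)[of "Suc n" "c (Suc n)"] c by simp
    then obtain b v where b: "\<forall>i\<in>{1..n}. b i \<in> R" and v: "v \<in> R"
      and cS: "c (Suc n) = (\<Sum>i=1..n. b i * p i) + D * v"
      unfolding partial_ideal_def by blast
    have syz: "(\<Sum>i=1..n. (c i + b i * p (Suc n)) * p i) = D * (u - v * p (Suc n))"
    proof -
      have "(\<Sum>i=1..n. (c i + b i * p (Suc n)) * p i)
          = (\<Sum>i=1..n. c i * p i) + (\<Sum>i=1..n. b i * p i) * p (Suc n)"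
        by (simp add: sum.distrib algebra_simps sum_distrib_left)
      also have "\<dots> = (\<Sum>i=1..n. c i * p i) + (c (Suc n) - D * v) * p (Suc n)"
        using cS by simp
      also have "\<dots> = D * (u - v * p (Suc n))"
        using eq by (simp add: algebra_simps)
      finally show ?thesis .
    qed
    have cR: "c i + b i * p (Suc n) \<in> R" if "i \<in> {1..n}" for i
      using b c pR that by auto
    have uR: "u - v * p (Suc n) \<in> R" using u v pR by auto
    obtain K e where K0: "\<forall>i\<in>{1..n}. \<forall>j\<in>{1..n}. K i j \<in> R \<and> K i j = - K j i"
      and e0: "\<forall>i\<in>{1..n}. e i \<in> R \<and> c i + b i * p (Suc n) = (\<Sum>j=1..n. K i j * p j) + D * e i"
      by (rule koszul_modE[OF IH, of "\<lambda>i. c i + b i * p (Suc n)", OF cR uR syz])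
    have K: "K i j \<in> R" "K i j = - K j i" if "i \<in> {1..n}" "j \<in> {1..n}" for i j
      using K0 that by blast+
    have e: "e i \<in> R" and ce: "c i + b i * p (Suc n) = (\<Sum>j=1..n. K i j * p j) + D * e i"
      if "i \<in> {1..n}" for i using e0 that by blast+
    \<comment> \<open>The subtracted syzygies are restored by bordering \<open>K\<close> with the
      row \<open>b\<close> and the column \<open>- b\<close>.\<close>
    define M where "M i j = (if i = Suc n then (if j = Suc n then 0 else b j)
       else if j = Suc n then - b i else K i j)" for i j
    define f where "f i = (if i = Suc n then v else e i)" for i
    have "\<forall>i\<in>{1..Suc n}. \<forall>j\<in>{1..Suc n}. M i j \<in> R \<and> M i j = - M j i"
    proof (intro ballI conjI)
      fix i j assume "i \<in> {1..Suc n}" "j \<in> {1..Suc n}"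
      then have "i = Suc n \<or> i \<in> {1..n}" "j = Suc n \<or> j \<in> {1..n}" by auto
      then show "M i j \<in> R" using K(1) b by (auto simp: M_def)
      show "M i j = - M j i"
      proof (cases "i = Suc n \<or> j = Suc n")
        case False
        with \<open>i = Suc n \<or> i \<in> {1..n}\<close> \<open>j = Suc n \<or> j \<in> {1..n}\<close>
        have "K i j = - K j i" using K(2) by blast
        with False show ?thesis by (simp add: M_def)
      qed (auto simp: M_def)
    qed
    moreover have "\<forall>i\<in>{1..Suc n}. f i \<in> R" using e v by (auto simp: f_def le_Suc_eq)
    moreover have "c i = (\<Sum>j=1..Suc n. M i j * p j) + D * f i" if "i \<in> {1..Suc n}" for i
    proof (cases "i = Suc n")
      case True
      have "(\<Sum>j=1..n. M i j * p j) = (\<Sum>j=1..n. b j * p j)"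
        using True by (intro sum.cong) (auto simp: M_def)
      then show ?thesis using True cS by (simp add: M_def f_def)
    next
      case False
      then have i: "i \<in> {1..n}" using that by auto
      have "(\<Sum>j=1..n. M i j * p j) = (\<Sum>j=1..n. K i j * p j)"
        using False by (intro sum.cong) (auto simp: M_def)
      then show ?thesis using False ce[OF i] by (simp add: M_def f_def algebra_simps)
    qed
    ultimately show "\<exists>K e. (\<forall>i\<in>{1..Suc n}. \<forall>j\<in>{1..Suc n}. K i j \<in> R \<and> K i j = - K j i) \<and>
      (\<forall>i\<in>{1..Suc n}. e i \<in> R \<and> c i = (\<Sum>j=1..Suc n. K i j * p j) + D * e i)"
      by (intro exI[of _ M] exI[of _ f] conjI ballI) blast+
  qed
qed

text \<open>Exchanging the two sums turns the total into its negative; absence of 2-torsion is what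
  disposes of the diagonal terms.\<close>

lemma alternating_sum_zero:
  assumes two: "\<And>u::'a. u + u = 0 \<Longrightarrow> u = 0" and K: "\<And>i j. i \<in> I \<Longrightarrow> j \<in> I \<Longrightarrow> K i j = - K j i"
  shows "(\<Sum>i\<in>I. \<Sum>j\<in>I. K i j * (f i * f j)) = (0::'a)"
proof -
  let ?X = "\<Sum>i\<in>I. \<Sum>j\<in>I. K i j * (f i * f j)"
  have "?X = (\<Sum>j\<in>I. \<Sum>i\<in>I. K i j * (f i * f j))" by (rule sum.swap)
  also have "\<dots> = (\<Sum>j\<in>I. \<Sum>i\<in>I. - (K j i * (f j * f i)))"
  proof (intro sum.cong refl)
    fix l k assume "l \<in> I" "k \<in> I"
    then have "K k l = - K l k" by (rule K[rotated])
    then show "K k l * (f k * f l) = - (K l k * (f l * f k))" by (simp add: algebra_simps)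
  qed
  also have "\<dots> = - ?X" by (simp add: sum_negf)
  finally have "?X + ?X = 0" by (simp add: eq_neg_iff_add_eq_0)
  then show ?thesis by (rule two)
qed

text \<open>The quotient by the ideal of the \<open>z i\<close> and \<open>Y * (Y + 2 * D)\<close>
  has no \<open>D\<close>-torsion. Two uses of \<open>koszul_mod\<close> show that \<open>g\<close>
  lies in the ideal generated by the \<open>z i\<close> and \<open>D\<close>, with enough control
  over the coefficients to divide the given equation by \<open>D\<close>.\<close>

lemma koszul_torsion_free:
  fixes q a s z :: "nat \<Rightarrow> 'a" and D Y w :: 'a
  assumes fin: "finite I" and K: "koszul_mod D I q"
    and qR: "\<And>i. i \<in> I \<Longrightarrow> q i \<in> R" and aR: "\<And>i. i \<in> I \<Longrightarrow> a i \<in> R" and sR: "\<And>i. i \<in> I \<Longrightarrow> s i \<in> R"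
    and D: "\<And>u. D * u = 0 \<Longrightarrow> u = 0" and two: "\<And>u::'a. u + u = 0 \<Longrightarrow> u = 0"
    and as: "(\<Sum>i\<in>I. a i * s i) = 1"
    and Y: "Y = (\<Sum>i\<in>I. a i * q i)" and z: "\<And>i. z i = q i - s i * Y"
    and w: "w \<in> R" and al: "\<And>i. i \<in> I \<Longrightarrow> al i \<in> R" and g: "g \<in> R"
    and Dw: "D * w = (\<Sum>i\<in>I. al i * z i) + g * (Y * (Y + 2 * D))"
  obtains be g' where "\<And>i. i \<in> I \<Longrightarrow> be i \<in> R" "g' \<in> R"
    "w = (\<Sum>i\<in>I. be i * z i) + g' * (Y * (Y + 2 * D))"
proof -
  have YR: "Y \<in> R" unfolding Y using aR qR by (intro sum_mem mult_mem) auto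
  have zR: "z i \<in> R" if "i \<in> I" for i using z qR sR YR that by auto
  have az: "(\<Sum>i\<in>I. a i * z i) = 0"
  proof -
    have "(\<Sum>i\<in>I. a i * z i) = (\<Sum>i\<in>I. a i * q i) - (\<Sum>i\<in>I. a i * s i) * Y"
      unfolding z by (simp add: algebra_simps sum_subtractf sum_distrib_left)
    then show ?thesis using as Y by simp
  qed
  have zq: "(\<Sum>i\<in>I. c i * z i) = (\<Sum>i\<in>I. c i * q i)" if "(\<Sum>i\<in>I. c i * s i) = 0" for c
  proof -
    have "(\<Sum>i\<in>I. c i * z i) = (\<Sum>i\<in>I. c i * q i) - (\<Sum>i\<in>I. c i * s i) * Y"
      unfolding z by (simp add: algebra_simps sum_subtractf sum_distrib_left)
    then show ?thesis using that by simp
  qed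
  define S where "S = (\<Sum>i\<in>I. al i * s i)"
  \<comment> \<open>Subtracting a multiple of \<open>a\<close> does not change the combination of
    the \<open>z i\<close>, because \<open>\<Sum>i. a i * z i = 0\<close>. The multiple makes
    \<open>b\<close> orthogonal to \<open>s\<close>, and for such coefficients \<open>z\<close> may
    be replaced by \<open>q\<close>.\<close>
  define b where "b i = al i - S * a i" for i
  have SR: "S \<in> R" unfolding S_def using al sR by (intro sum_mem mult_mem) auto
  have bR: "b i \<in> R" if "i \<in> I" for i using that al SR aR by (auto simp: b_def)
  have bs: "(\<Sum>i\<in>I. b i * s i) = 0"
  proof -
    have "(\<Sum>i\<in>I. b i * s i) = (\<Sum>i\<in>I. al i * s i) - S * (\<Sum>i\<in>I. a i * s i)"
      unfolding b_def by (simp add: algebra_simps sum_subtractf sum_distrib_left)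
    then show ?thesis using as by (simp add: S_def)
  qed
  have "(\<Sum>i\<in>I. b i * z i) = (\<Sum>i\<in>I. al i * z i) - S * (\<Sum>i\<in>I. a i * z i)"
    unfolding b_def by (simp add: algebra_simps sum_subtractf sum_distrib_left)
  then have bz: "(\<Sum>i\<in>I. b i * z i) = (\<Sum>i\<in>I. al i * z i)" using az by simp
  \<comment> \<open>Modulo \<open>D\<close> the last generator is \<open>Y\<^sup>2\<close>; one
    factor \<open>Y\<close> is expanded as \<open>\<Sum>i. a i * q i\<close>, and the cross term
    \<open>2 * D * g * Y\<close> moves to the right.\<close>
  have "(\<Sum>i\<in>I. (b i + g * Y * a i) * q i) = (\<Sum>i\<in>I. b i * q i) + g * Y * Y"
    unfolding Y by (simp add: algebra_simps sum.distrib sum_distrib_left)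
  also have "\<dots> = D * (w - 2 * g * Y)"
    using Dw bz zq[OF bs] by (simp add: algebra_simps)
  finally have syz1: "(\<Sum>i\<in>I. (b i + g * Y * a i) * q i) = D * (w - 2 * g * Y)" .
  have bgR: "b i + g * Y * a i \<in> R" if "i \<in> I" for i using that bR g YR aR by auto
  have "2 \<in> R" using of_int_mem[of 2] by simp
  then have wR: "w - 2 * g * Y \<in> R" using w g YR by auto
  obtain L e where L0: "\<forall>i\<in>I. \<forall>j\<in>I. L i j \<in> R \<and> L i j = - L j i"
    and e0: "\<forall>i\<in>I. e i \<in> R \<and> b i + g * Y * a i = (\<Sum>j\<in>I. L i j * q j) + D * e i"
    by (rule koszul_modE[OF K, of "\<lambda>i. b i + g * Y * a i", OF bgR wR syz1])
  have L: "L i j \<in> R" and L': "L i j = - L j i" if "i \<in> I" "j \<in> I" for i j using L0 that by blast+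
  have eR: "e i \<in> R" and be: "b i + g * Y * a i = (\<Sum>j\<in>I. L i j * q j) + D * e i" if "i \<in> I" for i
    using e0 that by blast+
  define sL where "sL j = (\<Sum>i\<in>I. s i * L i j)" for j
  define ep where "ep = (\<Sum>i\<in>I. s i * e i)"
  have sLR: "sL j \<in> R" if "j \<in> I" for j
    unfolding sL_def using that L sR by (intro sum_mem mult_mem) auto
  have epR: "ep \<in> R" unfolding ep_def using sR eR by (intro sum_mem mult_mem) auto
  \<comment> \<open>Pairing with \<open>s\<close> isolates \<open>g * Y\<close>, since
    \<open>b\<close> is orthogonal to \<open>s\<close> and \<open>a\<close> pairs with it to 1.
    Expanding \<open>Y\<close> once more makes this a second syzygy of \<open>q\<close> modulo
    \<open>D\<close>.\<close>
  have gY: "g * Y = (\<Sum>j\<in>I. sL j * q j) + D * ep"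
  proof -
    have "(\<Sum>i\<in>I. s i * (b i + g * Y * a i)) = (\<Sum>i\<in>I. b i * s i) + g * Y * (\<Sum>i\<in>I. a i * s i)"
      by (simp add: algebra_simps sum.distrib sum_distrib_left)
    also have "\<dots> = g * Y" using as bs by simp
    finally have "g * Y = (\<Sum>i\<in>I. s i * (b i + g * Y * a i))" by simp
    also have "\<dots> = (\<Sum>i\<in>I. s i * ((\<Sum>j\<in>I. L i j * q j) + D * e i))" using be by simp
    also have "\<dots> = (\<Sum>i\<in>I. \<Sum>j\<in>I. s i * L i j * q j) + D * ep"
      unfolding ep_def by (simp add: algebra_simps sum.distrib sum_distrib_left)
    also have "(\<Sum>i\<in>I. \<Sum>j\<in>I. s i * L i j * q j) = (\<Sum>j\<in>I. sL j * q j)"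
      unfolding sL_def sum_distrib_right by (rule sum.swap)
    finally show ?thesis .
  qed
  have "(\<Sum>j\<in>I. (g * a j - sL j) * q j) = g * Y - (\<Sum>j\<in>I. sL j * q j)"
    unfolding Y by (simp add: algebra_simps sum_subtractf sum_distrib_left)
  then have syz2: "(\<Sum>j\<in>I. (g * a j - sL j) * q j) = D * ep" using gY by simp
  have gaR: "g * a j - sL j \<in> R" if "j \<in> I" for j using that g aR sLR by auto
  obtain M f where M0: "\<forall>i\<in>I. \<forall>j\<in>I. M i j \<in> R \<and> M i j = - M j i"
    and f0: "\<forall>i\<in>I. f i \<in> R \<and> g * a i - sL i = (\<Sum>j\<in>I. M i j * q j) + D * f i"
    by (rule koszul_modE[OF K, of "\<lambda>j. g * a j - sL j", OF gaR epR syz2])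
  have M: "M i j \<in> R" and M': "M i j = - M j i" if "i \<in> I" "j \<in> I" for i j using M0 that by blast+
  have fR: "f i \<in> R" and ge: "g * a i - sL i = (\<Sum>j\<in>I. M i j * q j) + D * f i" if "i \<in> I" for i
    using f0 that by blast+
  define t where "t k = (\<Sum>j\<in>I. s j * M j k)" for k
  define ph where "ph = (\<Sum>i\<in>I. s i * f i)"
  have tR: "t j \<in> R" if "j \<in> I" for j
    unfolding t_def using that M sR by (intro sum_mem mult_mem) auto
  have phR: "ph \<in> R" unfolding ph_def using sR fR by (intro sum_mem mult_mem) auto
  have sLs: "(\<Sum>j\<in>I. sL j * s j) = 0"
  proof -
    have "(\<Sum>j\<in>I. sL j * s j) = (\<Sum>j\<in>I. \<Sum>i\<in>I. L i j * (s i * s j))"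
      unfolding sL_def by (simp add: sum_distrib_left sum_distrib_right algebra_simps)
    also have "\<dots> = (\<Sum>i\<in>I. \<Sum>j\<in>I. L i j * (s i * s j))" by (rule sum.swap)
    also have "\<dots> = 0" by (rule alternating_sum_zero[OF two L'])
    finally show ?thesis .
  qed
  have ts: "(\<Sum>j\<in>I. t j * s j) = 0"
  proof -
    have "(\<Sum>j\<in>I. t j * s j) = (\<Sum>j\<in>I. \<Sum>i\<in>I. M i j * (s i * s j))"
      unfolding t_def by (simp add: sum_distrib_left sum_distrib_right algebra_simps)
    also have "\<dots> = (\<Sum>i\<in>I. \<Sum>j\<in>I. M i j * (s i * s j))" by (rule sum.swap)
    also have "\<dots> = 0" by (rule alternating_sum_zero[OF two M'])
    finally show ?thesis .
  qed
  \<comment> \<open>Pairing the second syzygy with \<open>s\<close> isolates \<open>g\<close>: the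
    contribution of \<open>sL\<close> vanishes by antisymmetry of \<open>L\<close>. Antisymmetry of
    \<open>M\<close> makes \<open>t\<close> orthogonal to \<open>s\<close>, so \<open>q\<close> can
    again be replaced by \<open>z\<close>.\<close>
  have "g = g * (\<Sum>i\<in>I. a i * s i) - (\<Sum>j\<in>I. sL j * s j)" using as sLs by simp
  also have "\<dots> = (\<Sum>i\<in>I. s i * (g * a i - sL i))"
    by (simp add: algebra_simps sum_subtractf sum_distrib_left)
  also have "\<dots> = (\<Sum>i\<in>I. s i * ((\<Sum>j\<in>I. M i j * q j) + D * f i))" using ge by simp
  also have "\<dots> = (\<Sum>i\<in>I. \<Sum>j\<in>I. s i * M i j * q j) + D * ph"
    unfolding ph_def by (simp add: algebra_simps sum.distrib sum_distrib_left)
  also have "(\<Sum>i\<in>I. \<Sum>j\<in>I. s i * M i j * q j) = (\<Sum>j\<in>I. t j * q j)"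
    unfolding t_def sum_distrib_right by (rule sum.swap)
  finally have g_eq: "g = (\<Sum>i\<in>I. t i * z i) + D * ph" using zq[OF ts] by simp
  \<comment> \<open>After substituting \<open>q j = z j + s j * Y\<close>, the part quadratic in
    \<open>z\<close> cancels by antisymmetry and only a multiple of \<open>Y\<close>
    remains.\<close>
  have Kz: "(\<Sum>i\<in>I. (\<Sum>j\<in>I. N i j * q j) * z i) = - Y * (\<Sum>i\<in>I. (\<Sum>j\<in>I. s j * N j i) * z i)"
    if N: "\<And>i j. i \<in> I \<Longrightarrow> j \<in> I \<Longrightarrow> N i j = - N j i" for N
  proof -
    have "(\<Sum>i\<in>I. (\<Sum>j\<in>I. N i j * q j) * z i) = (\<Sum>i\<in>I. (\<Sum>j\<in>I. N i j * (z j + s j * Y)) * z i)"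
      unfolding z by simp
    also have "\<dots> = (\<Sum>i\<in>I. \<Sum>j\<in>I. N i j * (z i * z j)) + (\<Sum>i\<in>I. \<Sum>j\<in>I. Y * (s j * N i j * z i))"
      by (simp add: sum_distrib_left sum_distrib_right sum.distrib algebra_simps)
    also have "(\<Sum>i\<in>I. \<Sum>j\<in>I. N i j * (z i * z j)) = 0" by (rule alternating_sum_zero[OF two N])
    also have "(\<Sum>i\<in>I. \<Sum>j\<in>I. Y * (s j * N i j * z i)) = (\<Sum>i\<in>I. \<Sum>j\<in>I. - Y * (s j * N j i * z i))"
    proof (intro sum.cong refl)
      fix i j assume "i \<in> I" "j \<in> I"
      then have "N i j = - N j i" by (rule N)
      then show "Y * (s j * N i j * z i) = - Y * (s j * N j i * z i)" by simp
    qed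
    also have "\<dots> = - Y * (\<Sum>i\<in>I. (\<Sum>j\<in>I. s j * N j i) * z i)"
      by (simp add: sum_distrib_right sum_distrib_left)
    finally show ?thesis by simp
  qed
  define E where "E = (\<Sum>i\<in>I. e i * z i)"
  define F where "F = (\<Sum>i\<in>I. f i * z i)"
  define Z where "Z = (\<Sum>i\<in>I. t i * z i)"
  have "(\<Sum>i\<in>I. sL i * z i) = (\<Sum>i\<in>I. (g * a i - ((\<Sum>j\<in>I. M i j * q j) + D * f i)) * z i)"
    by (intro sum.cong refl) (simp only: ge[symmetric] diff_diff_eq2, simp)
  also have "\<dots> = g * (\<Sum>i\<in>I. a i * z i) - (\<Sum>i\<in>I. (\<Sum>j\<in>I. M i j * q j) * z i) - D * F"
    unfolding F_def by (simp add: algebra_simps sum_subtractf sum.distrib sum_distrib_left)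
  also have "\<dots> = Y * Z - D * F" using az Kz[OF M'] by (simp add: Z_def t_def)
  finally have sLz: "(\<Sum>i\<in>I. sL i * z i) = Y * Z - D * F" .
  have "(\<Sum>i\<in>I. b i * z i) = (\<Sum>i\<in>I. ((\<Sum>j\<in>I. L i j * q j) + D * e i - g * Y * a i) * z i)"
    by (intro sum.cong refl) (simp only: be[symmetric] add_diff_cancel)
  also have "\<dots> = (\<Sum>i\<in>I. (\<Sum>j\<in>I. L i j * q j) * z i) + D * E - g * Y * (\<Sum>i\<in>I. a i * z i)"
    unfolding E_def by (simp add: algebra_simps sum_subtractf sum.distrib sum_distrib_left)
  also have "\<dots> = - Y * (Y * Z - D * F) + D * E"
    using az Kz[OF L'] sLz by (simp add: sL_def)
  finally have bz': "(\<Sum>i\<in>I. al i * z i) = - Y * (Y * Z - D * F) + D * E" using bz by simp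
  \<comment> \<open>The only terms without a factor \<open>D\<close> are \<open>- Y * Y * Z\<close>,
    from the combination of the \<open>z i\<close>, and \<open>Z * Y * Y\<close>, from
    \<open>g\<close>; they cancel.\<close>
  have "D * (w - (E + Y * F + 2 * Y * Z + ph * (Y * (Y + 2 * D)))) = 0"
    using Dw unfolding bz' g_eq Z_def[symmetric] by (simp add: algebra_simps)
  then have "w - (E + Y * F + 2 * Y * Z + ph * (Y * (Y + 2 * D))) = 0" by (rule D)
  then have w_eq: "w = E + Y * F + 2 * Y * Z + ph * (Y * (Y + 2 * D))" by simp
  show thesis
  proof (rule that[of "\<lambda>i. e i + Y * f i + 2 * Y * t i" ph])
    show "e i + Y * f i + 2 * Y * t i \<in> R" if "i \<in> I" for i
      using that eR fR tR YR \<open>2 \<in> R\<close> by (intro add_mem mult_mem) auto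
    show "w = (\<Sum>i\<in>I. (e i + Y * f i + 2 * Y * t i) * z i) + ph * (Y * (Y + 2 * D))"
      unfolding w_eq E_def F_def Z_def by (simp add: algebra_simps sum.distrib sum_distrib_left)
  qed (rule phR)
qed

end

section \<open>Group rings\<close>

subsection \<open>Restricting the support\<close>

text \<open>With \<open>S\<close> a level set of a degree this is the projection to a homogeneous
  component. It serves both the degree in one basis vector and the parity given by
  \<open>T\<close>.\<close>

definition restr :: "'k set \<Rightarrow> ('k \<Rightarrow>\<^sub>0 'b::comm_monoid_add) \<Rightarrow> ('k \<Rightarrow>\<^sub>0 'b)" where
  "restr S p = (\<Sum>k\<in>Poly_Mapping.keys p \<inter> S. Poly_Mapping.single k (Poly_Mapping.lookup p k))"

lemma lookup_restr:
  "Poly_Mapping.lookup (restr S p) k = (if k \<in> S then Poly_Mapping.lookup p k else 0)"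
proof -
  have "Poly_Mapping.lookup (restr S p) k
      = (\<Sum>m\<in>Poly_Mapping.keys p \<inter> S. if m = k then Poly_Mapping.lookup p k else 0)"
    unfolding restr_def lookup_sum by (intro sum.cong) (auto simp: lookup_single when_def)
  then show ?thesis by (auto simp: in_keys_iff)
qed

lemma restr_add: "restr S (p + q) = restr S p + restr S q"
  by (rule poly_mapping_eqI) (simp add: lookup_restr lookup_add)

lemma restr_zero [simp]: "restr S 0 = 0"
  by (rule poly_mapping_eqI) (simp add: lookup_restr)

lemma restr_sum: "restr S (sum f I) = (\<Sum>i\<in>I. restr S (f i))"
  by (induction I rule: infinite_finite_induct) (simp_all add: restr_add)

lemma restr_diff: "restr S (p - q) = restr S p - restr S (q :: 'k \<Rightarrow>\<^sub>0 'b::ab_group_add)"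
  by (rule poly_mapping_eqI) (simp add: lookup_restr lookup_minus)

lemma keys_restr: "Poly_Mapping.keys (restr S p) = Poly_Mapping.keys p \<inter> S"
  by (auto simp: in_keys_iff lookup_restr split: if_splits)

lemma restr_id: "Poly_Mapping.keys p \<subseteq> S \<Longrightarrow> restr S p = p"
  by (rule poly_mapping_eqI) (auto simp: lookup_restr in_keys_iff)

lemma sum_monomials:
  "(\<Sum>k\<in>Poly_Mapping.keys p. Poly_Mapping.single k (Poly_Mapping.lookup p k)) = p"
  using restr_id[of p UNIV] by (simp add: restr_def)

lemma restr_empty: "Poly_Mapping.keys p \<inter> S = {} \<Longrightarrow> restr S p = 0"
  by (rule poly_mapping_eqI) (auto simp: lookup_restr in_keys_iff)

lemma restr_split: "p = restr S p + restr (- S) p"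
  by (rule poly_mapping_eqI) (simp add: lookup_restr lookup_add)

lemma restr_single: "restr S (Poly_Mapping.single k c) = (if k \<in> S then Poly_Mapping.single k c else 0)"
  by (rule poly_mapping_eqI) (auto simp: lookup_restr lookup_single when_def)

text \<open>When the second factor is homogeneous, membership of a sum of exponents in
  \<open>S\<close> depends on the first exponent alone. The choices \<open>S' = UNIV\<close> and
  \<open>S' = {}\<close> cover products supported entirely inside or entirely outside
  \<open>S\<close>.\<close>

lemma restr_mult:
  fixes p q :: "'k::monoid_add \<Rightarrow>\<^sub>0 'b::semiring_0"
  assumes "\<And>m b. m \<in> Poly_Mapping.keys p \<Longrightarrow> b \<in> Poly_Mapping.keys q \<Longrightarrow> m + b \<in> S \<longleftrightarrow> m \<in> S'"
  shows "restr S (p * q) = restr S' p * q"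
proof -
  let ?m = "\<lambda>p k. Poly_Mapping.single k (Poly_Mapping.lookup p k)"
  have "restr S (p * q) = restr S ((\<Sum>m\<in>Poly_Mapping.keys p. ?m p m) * (\<Sum>b\<in>Poly_Mapping.keys q. ?m q b))"
    by (simp add: sum_monomials)
  also have "\<dots> = (\<Sum>m\<in>Poly_Mapping.keys p. \<Sum>b\<in>Poly_Mapping.keys q. restr S (?m p m * ?m q b))"
    by (simp add: sum_product restr_sum)
  also have "\<dots> = (\<Sum>m\<in>Poly_Mapping.keys p. \<Sum>b\<in>Poly_Mapping.keys q. restr S' (?m p m) * ?m q b)"
    using assms by (intro sum.cong refl) (simp add: mult_single restr_single)
  also have "\<dots> = restr S' (\<Sum>m\<in>Poly_Mapping.keys p. ?m p m) * (\<Sum>b\<in>Poly_Mapping.keys q. ?m q b)"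
    by (simp add: sum_product restr_sum)
  finally show ?thesis by (simp add: sum_monomials)
qed

section \<open>Group rings as subrings without integer torsion\<close>

lemma csubring_group_ring:
  fixes L :: "(real^'n) set"
  assumes "0 \<in> L" "\<And>u v. u \<in> L \<Longrightarrow> v \<in> L \<Longrightarrow> u + v \<in> L"
  shows "csubring (group_ring_on L)"
proof
  fix u v :: "'n grp_ring" assume uv: "u \<in> group_ring_on L" "v \<in> group_ring_on L"
  show "u + v \<in> group_ring_on L"
    using uv Poly_Mapping.keys_add[of u v] by (auto simp: group_ring_on_def)
  show "u * v \<in> group_ring_on L"
    using uv keys_mult[of u v] assms(2) by (fastforce simp: group_ring_on_def)
qed (use assms in \<open>auto simp: group_ring_on_def\<close>)

lemma grp_ring_of_int_mult: "Poly_Mapping.lookup (of_int d * u) k = d * Poly_Mapping.lookup (u :: 'n::finite grp_ring) k"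
proof -
  have "(of_int d :: 'n grp_ring) = Poly_Mapping.single 0 d"
    by (metis single_of_int of_int_eq_id id_apply)
  then have "of_int d * u = Poly_Mapping.map ((*) d) u"
    by (simp only: mult_map_scale_conv_mult)
  then show ?thesis
    by (simp add: Poly_Mapping.map.rep_eq when_def)
qed

lemma grp_ring_torsion_free:
  fixes u :: "('n::finite) grp_ring"
  assumes "d \<noteq> 0" "of_int d * u = 0"
  shows "u = 0"
proof (rule poly_mapping_eqI)
  fix k show "Poly_Mapping.lookup u k = Poly_Mapping.lookup 0 k"
    using arg_cong[OF assms(2), of "\<lambda>p. Poly_Mapping.lookup p k"] assms(1)
    by (simp add: grp_ring_of_int_mult)
qed

subsection \<open>Flat tuples are regular sequences modulo every integer\<close>

text \<open>Multiplication by \<open>p\<close> is injective modulo a homogeneous ideal, because the component of least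
  degree of \<open>p\<close> is a unit.\<close>
lemma mult_regular_lowest_unit:
  fixes L :: "(real^'n) set" and deg :: "real^'n \<Rightarrow> int" and p :: "'n grp_ring"
  defines "R \<equiv> group_ring_on L"
  assumes L: "0 \<in> L" "\<And>u v. u \<in> L \<Longrightarrow> v \<in> L \<Longrightarrow> u + v \<in> L" "\<And>u. u \<in> L \<Longrightarrow> - u \<in> L"
    and deg: "\<And>u v. u \<in> L \<Longrightarrow> v \<in> L \<Longrightarrow> deg (u + v) = deg u + deg v"
    and J: "csubring.ideal R J" and hom: "\<And>j u. u \<in> J \<Longrightarrow> restr {v. deg v = j} u \<in> J"
    and pR: "p \<in> R" and b: "b \<in> L" "deg b = k"
    and low: "\<And>v. v \<in> Poly_Mapping.keys (p - ex b) \<Longrightarrow> deg v > k"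
    and c: "c \<in> R" "p * c \<in> J"
  shows "c \<in> J"
  using c
proof (induction "card (Poly_Mapping.keys c)" arbitrary: c rule: less_induct)
  case less
  interpret R: csubring R unfolding R_def using L by (intro csubring_group_ring)
  show ?case
  proof (cases "c = 0")
    case True
    then show ?thesis using R.ideal_zero[OF J] by simp
  next
    case False
    define j where "j = Min (deg ` Poly_Mapping.keys c)"
    have "Poly_Mapping.keys c \<noteq> {}" using False by simp
    then have jin: "j \<in> deg ` Poly_Mapping.keys c" unfolding j_def by (intro Min_in) auto
    have jle: "j \<le> deg v" if "v \<in> Poly_Mapping.keys c" for v
      unfolding j_def using that by (intro Min_le) auto
    define S where "S i = {v. deg v = i}" for i
    define c0 where "c0 = restr (S j) c"
    define c1 where "c1 = restr (- S j) c"
    have cc: "c = c0 + c1" unfolding c0_def c1_def by (rule restr_split)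
    have cL: "v \<in> L" if "v \<in> Poly_Mapping.keys c" for v using less.prems(1) that by (auto simp: R_def group_ring_on_def)
    have c0R: "c0 \<in> R" "c1 \<in> R" using cL by (auto simp: R_def group_ring_on_def c0_def c1_def keys_restr)
    have c1k: "deg v > j" if "v \<in> Poly_Mapping.keys c1" for v
      using that jle[of v] by (auto simp: c1_def keys_restr S_def)
    have c1L: "v \<in> L" if "v \<in> Poly_Mapping.keys c1" for v using that cL by (auto simp: c1_def keys_restr)
    have c0k: "deg v = j" if "v \<in> Poly_Mapping.keys c0" for v
      using that by (auto simp: c0_def keys_restr S_def)
    have c0L: "v \<in> L" if "v \<in> Poly_Mapping.keys c0" for v using that cL by (auto simp: c0_def keys_restr)
    have exR: "ex b \<in> R" "ex (- b) \<in> R" using b L(3) by (auto simp: R_def group_ring_on_def)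
    define p1 where "p1 = p - ex b"
    have p1R: "p1 \<in> R" unfolding p1_def using pR exR by auto
    then have p1L: "v \<in> L" if "v \<in> Poly_Mapping.keys p1" for v using that by (auto simp: R_def group_ring_on_def)
    \<comment> \<open>Only \<open>ex b * c0\<close> contributes in degree \<open>k + j\<close>; the
      rest lives in larger degrees. Homogeneity of \<open>J\<close> then puts this component into
      \<open>J\<close>.\<close>
    have "p * c = ex b * c0 + (ex b * c1 + p1 * c)"
      by (simp add: p1_def cc algebra_simps)
    moreover have "restr (S (k + j)) (ex b * c0) = ex b * c0"
    proof -
      have "restr (S (k + j)) (ex b * c0) = restr UNIV (ex b) * c0"
        using b c0k c0L deg by (intro restr_mult) (auto simp: S_def split: if_splits)
      then show ?thesis by (simp add: restr_id)
    qed
    moreover have "restr (S (k + j)) (ex b * c1) = 0"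
    proof -
      have "restr (S (k + j)) (ex b * c1) = restr {} (ex b) * c1"
        using b c1k c1L deg by (intro restr_mult) (auto simp: S_def split: if_splits)
      then show ?thesis by (simp add: restr_empty)
    qed
    moreover have "restr (S (k + j)) (p1 * c) = 0"
    proof -
      have "restr (S (k + j)) (p1 * c) = restr {} p1 * c"
      proof (rule restr_mult)
        fix m v assume "m \<in> Poly_Mapping.keys p1" "v \<in> Poly_Mapping.keys c"
        then have "deg (m + v) > k + j" using low jle[of v] deg p1L cL unfolding p1_def[symmetric] by fastforce
        then show "m + v \<in> S (k + j) \<longleftrightarrow> m \<in> {}" by (simp add: S_def)
      qed
      then show ?thesis by (simp add: restr_empty)
    qed
    ultimately have "restr (S (k + j)) (p * c) = ex b * c0" by (simp add: restr_add)
    then have "ex b * c0 \<in> J" using hom[OF less.prems(2), of "k + j"] by (simp add: S_def)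
    then have "ex (- b) * (ex b * c0) \<in> J" using R.ideal_mult[OF J] exR by blast
    then have c0J: "c0 \<in> J" by (simp add: mult.assoc[symmetric] mult_single)
    \<comment> \<open>Removing the non-zero lowest component shrinks the support, so the induction
      hypothesis reaches \<open>c1\<close>.\<close>
    have "card (Poly_Mapping.keys c1) < card (Poly_Mapping.keys c)"
      using jin by (intro psubset_card_mono) (auto simp: c1_def keys_restr S_def)
    moreover have "p * c1 \<in> J"
    proof -
      have "p * c1 = p * c - p * c0" by (simp add: cc algebra_simps)
      then show ?thesis
        using R.ideal_diff[OF J less.prems(2)] R.ideal_mult[OF J pR c0J] by simp
    qed
    ultimately have "c1 \<in> J" using less.hyps c0R by blast
    then show ?thesis unfolding cc using R.ideal_add[OF J c0J] by blast
  qed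
qed

section \<open>Integer spans and coordinates\<close>

lemma int_spanI: "u = (\<Sum>j=1..n. of_int (c j) *\<^sub>R x j) \<Longrightarrow> u \<in> int_span n x"
  unfolding int_span_def by blast

lemma int_span_mono: "i \<le> n \<Longrightarrow> int_span i x \<subseteq> int_span n x"
proof
  fix u assume "i \<le> n" "u \<in> int_span i x"
  then obtain c where u: "u = (\<Sum>j=1..i. of_int (c j) *\<^sub>R x j)" unfolding int_span_def by blast
  have "u = (\<Sum>j=1..n. of_int (if j \<le> i then c j else 0) *\<^sub>R x j)"
    unfolding u using \<open>i \<le> n\<close> by (intro sum.mono_neutral_cong_left) auto
  then show "u \<in> int_span n x"
    by (rule int_spanI)
qed

lemma int_span_zero: "0 \<in> int_span n x"
  unfolding int_span_def by (intro CollectI exI[of _ "\<lambda>_. 0"]) simp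

lemma int_span_add: "u \<in> int_span n x \<Longrightarrow> v \<in> int_span n x \<Longrightarrow> u + v \<in> int_span n x"
proof -
  assume "u \<in> int_span n x" "v \<in> int_span n x"
  then obtain c c' where "u = (\<Sum>j=1..n. of_int (c j) *\<^sub>R x j)" "v = (\<Sum>j=1..n. of_int (c' j) *\<^sub>R x j)"
    unfolding int_span_def by blast
  then have "u + v = (\<Sum>j=1..n. of_int (c j + c' j) *\<^sub>R x j)"
    by (simp add: scaleR_add_left sum.distrib)
  then show ?thesis by (rule int_spanI)
qed

lemma int_span_uminus: "u \<in> int_span n x \<Longrightarrow> - u \<in> int_span n x"
proof -
  assume "u \<in> int_span n x"
  then obtain c where "u = (\<Sum>j=1..n. of_int (c j) *\<^sub>R x j)"
    unfolding int_span_def by blast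
  then have "- u = (\<Sum>j=1..n. of_int (- c j) *\<^sub>R x j)"
    by (simp add: sum_negf)
  then show ?thesis by (rule int_spanI)
qed

text \<open>Independence makes the coefficients at \<open>{1..n}\<close> unique, so an arbitrary
  choice of representation will do. Later the coordinate at \<open>i\<close> serves as the degree in
  \<open>x i\<close>.\<close>

lemma Z_basis_coordinates:
  assumes "is_Z_basis L n x"
  obtains crd :: "real^'n \<Rightarrow> nat \<Rightarrow> int" where
    "\<And>c i. i \<in> {1..n} \<Longrightarrow> crd (\<Sum>j=1..n. of_int (c j) *\<^sub>R x j) i = c i"
proof -
  define crd where "crd u = (SOME c::nat \<Rightarrow> int. u = (\<Sum>j=1..n. of_int (c j) *\<^sub>R x j))" for u
  have "crd (\<Sum>j=1..n. of_int (c j) *\<^sub>R x j) i = c i" if i: "i \<in> {1..n}" for c i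
  proof -
    define u where "u = (\<Sum>j=1..n. of_int (c j) *\<^sub>R x j)"
    have "u = (\<Sum>j=1..n. of_int (crd u j) *\<^sub>R x j)"
      unfolding crd_def by (rule someI[of _ c]) (rule u_def)
    then have "(\<Sum>j=1..n. of_int (crd u j - c j) *\<^sub>R x j) = 0"
      using u_def by (simp add: scaleR_diff_left sum_subtractf)
    then have "crd u i - c i = 0"
      using assms[unfolded is_Z_basis_def, THEN conjunct2, rule_format, of "\<lambda>j. crd u j - c j"] i by blast
    then show ?thesis by (simp add: u_def)
  qed
  then show thesis by (rule that)
qed

text \<open>The lowest coefficient of \<open>p k\<close> in \<open>x k\<close> is a monomial with
  coefficient 1, a unit modulo every \<open>d\<close>, while the earlier entries have degree 0 in
  \<open>x k\<close> and so generate a homogeneous ideal. Hence \<open>p k\<close> is regular modulo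
  its predecessors and \<open>d\<close>.\<close>

lemma flat_koszul_mod:
  fixes p :: "nat \<Rightarrow> ('n::finite) grp_ring"
  assumes basis: "is_Z_basis L n x" and flat: "flat n x p" and d: "d \<noteq> 0"
  shows "csubring.koszul_mod (group_ring_on L) (of_int d) {1..n} p"
proof -
  have L: "L = int_span n x" using basis by (simp add: is_Z_basis_def)
  have L0: "0 \<in> L" and Ladd: "\<And>u v. u \<in> L \<Longrightarrow> v \<in> L \<Longrightarrow> u + v \<in> L" and Luminus: "\<And>u. u \<in> L \<Longrightarrow> - u \<in> L"
    unfolding L by (auto intro: int_span_zero int_span_add int_span_uminus)
  let ?R = "group_ring_on L"
  interpret R: csubring ?R using L0 Ladd by (intro csubring_group_ring)
  from Z_basis_coordinates[OF basis] obtain crd :: "real^'n \<Rightarrow> nat \<Rightarrow> int" where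
    crd: "\<And>c i. i \<in> {1..n} \<Longrightarrow> crd (\<Sum>j=1..n. of_int (c j) *\<^sub>R x j) i = c i" by blast
  have crd_add: "crd (u + v) i = crd u i + crd v i" if uv: "u \<in> L" "v \<in> L" and i: "i \<in> {1..n}" for u v i
  proof -
    obtain c c' where c: "u = (\<Sum>j=1..n. of_int (c j) *\<^sub>R x j)" "v = (\<Sum>j=1..n. of_int (c' j) *\<^sub>R x j)"
      using uv unfolding L int_span_def by blast
    then have "u + v = (\<Sum>j=1..n. of_int (c j + c' j) *\<^sub>R x j)"
      by (simp add: scaleR_add_left sum.distrib)
    then show ?thesis using crd[OF i, of "\<lambda>j. c j + c' j"] crd[OF i, of c] crd[OF i, of c'] c by metis
  qed
  have crd_low: "crd u i = 0" if uk: "u \<in> int_span k x" and ik: "k < i" "i \<in> {1..n}" for u i k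
  proof -
    obtain c where u: "u = (\<Sum>j=1..k. of_int (c j) *\<^sub>R x j)" using uk unfolding int_span_def by blast
    have "u = (\<Sum>j=1..n. of_int (if j \<le> k then c j else 0) *\<^sub>R x j)"
      unfolding u using ik by (intro sum.mono_neutral_cong_left) auto
    then show ?thesis using crd[OF ik(2), of "\<lambda>j. if j \<le> k then c j else 0"] ik(1) by simp
  qed
  have crd_x: "crd (of_int j *\<^sub>R x i) i = j" if "i \<in> {1..n}" for i j
  proof -
    have "(\<Sum>l=1..n. of_int (if l = i then j else 0) *\<^sub>R x l) = (\<Sum>l=1..n. if l = i then of_int j *\<^sub>R x l else 0)"
      by (intro sum.cong) auto
    also have "\<dots> = of_int j *\<^sub>R x i" using that by simp
    finally show ?thesis using crd[OF that, of "\<lambda>l. if l = i then j else 0"] by simp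
  qed
  have xL: "of_int j *\<^sub>R x i \<in> L" if "i \<in> {1..n}" for i and j :: int
  proof -
    have "(\<Sum>l=1..n. of_int (if l = i then j else 0) *\<^sub>R x l) = (\<Sum>l=1..n. if l = i then of_int j *\<^sub>R x l else 0)"
      by (intro sum.cong) auto
    also have "\<dots> = of_int j *\<^sub>R x i" using that by simp
    finally show ?thesis unfolding L by (rule int_spanI[OF sym])
  qed
  have keysp: "Poly_Mapping.keys (p i) \<subseteq> int_span i x" if "i \<in> {1..n}" for i
    using flat that unfolding flat_def group_ring_on_def by blast
  show ?thesis
  proof (rule R.koszul_mod_regular)
    show "p k \<in> ?R" if "k \<in> {1..n}" for k
      using keysp[OF that] int_span_mono[of k n x] that by (auto simp: group_ring_on_def L)
    show "u = 0" if "of_int d * u = (0 :: 'n grp_ring)" for u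
      using grp_ring_torsion_free[OF d that] .
  next
    fix k c assume k: "k \<in> {1..n}" and c: "c \<in> ?R" "p k * c \<in> R.partial_ideal (of_int d) p (k - 1)"
    define E where "E = {j::int. \<exists>m\<in>int_span (k - 1) x. Poly_Mapping.lookup (p k) (m + of_int j *\<^sub>R x k) \<noteq> 0}"
    define K where "K = Min E"
    have div: "divisor_wrt x k (p k)" using flat k unfolding flat_def by blast
    then obtain mu where mu: "mu \<in> int_span (k - 1) x"
      and lk: "\<And>m. m \<in> int_span (k - 1) x \<Longrightarrow>
         Poly_Mapping.lookup (p k) (m + of_int K *\<^sub>R x k) = (if m = mu then 1 else 0)"
      unfolding divisor_wrt_def Let_def E_def[symmetric] K_def[symmetric] by blast
    have subL: "u \<in> L" if "u \<in> int_span (k - 1) x" for u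
    proof -
      have "k - 1 \<le> n" using k by auto
      then show ?thesis using int_span_mono[of "k - 1" n x] that unfolding L by blast
    qed
    have crdk: "crd (m + of_int j *\<^sub>R x k) k = j" if "m \<in> int_span (k - 1) x" for m j
      using crd_add[OF subL[OF that] xL[OF k] k] crd_low[OF that _ k] crd_x[OF k] k by simp
    have split: "\<exists>m\<in>int_span (k - 1) x. v = m + of_int (crd v k) *\<^sub>R x k" if v: "v \<in> Poly_Mapping.keys (p k)" for v
    proof -
      obtain c where c: "v = (\<Sum>j=1..k. of_int (c j) *\<^sub>R x j)"
        using v keysp[OF k] unfolding int_span_def by blast
      define m where "m = (\<Sum>j=1..k - 1. of_int (c j) *\<^sub>R x j)"
      have m: "m \<in> int_span (k - 1) x" unfolding m_def int_span_def by blast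
      have "v = m + of_int (c k) *\<^sub>R x k" using k by (cases k) (auto simp: c m_def)
      then show ?thesis using m crdk[OF m] by auto
    qed
    \<comment> \<open>Finiteness of \<open>E\<close> is needed for \<open>Min E\<close> to be an
      actual lower bound of the exponents.\<close>
    have "E \<subseteq> (\<lambda>v. crd v k) ` Poly_Mapping.keys (p k)"
    proof
      fix j assume "j \<in> E"
      then obtain m where m: "m \<in> int_span (k - 1) x" "m + of_int j *\<^sub>R x k \<in> Poly_Mapping.keys (p k)"
        unfolding E_def by (auto simp: in_keys_iff)
      then show "j \<in> (\<lambda>v. crd v k) ` Poly_Mapping.keys (p k)" using crdk[OF m(1), of j] by force
    qed
    then have "finite E" by (rule finite_subset) simp
    have Kle: "K \<le> crd v k" if v: "v \<in> Poly_Mapping.keys (p k)" for v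
    proof -
      obtain m where m: "m \<in> int_span (k - 1) x" "v = m + of_int (crd v k) *\<^sub>R x k" using split[OF v] by blast
      have "Poly_Mapping.lookup (p k) (m + of_int (crd v k) *\<^sub>R x k) \<noteq> 0"
        using v[unfolded in_keys_iff] by (subst m(2)[symmetric])
      then have "crd v k \<in> E" using m(1) unfolding E_def by blast
      then show ?thesis unfolding K_def using \<open>finite E\<close> by simp
    qed
    define b where "b = mu + of_int K *\<^sub>R x k"
    have low: "crd v k > K" if v: "v \<in> Poly_Mapping.keys (p k - ex b)" for v
    proof (rule ccontr)
      assume nless: "\<not> ?thesis"
      have "v \<noteq> b" using v lk[OF mu] by (auto simp: in_keys_iff lookup_minus b_def)
      then have vk: "v \<in> Poly_Mapping.keys (p k)"
        using v by (auto simp: in_keys_iff lookup_minus lookup_single_not_eq)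
      then have "crd v k = K" using Kle nless by force
      then obtain m where m: "m \<in> int_span (k - 1) x" "v = m + of_int K *\<^sub>R x k" using split[OF vk] by auto
      then have "m \<noteq> mu" using \<open>v \<noteq> b\<close> by (auto simp: b_def)
      then show False using vk m lk[OF m(1)] by (simp add: in_keys_iff)
    qed
    show "c \<in> R.partial_ideal (of_int d) p (k - 1)"
    proof (rule mult_regular_lowest_unit[where L = L and deg = "\<lambda>v. crd v k" and p = "p k" and b = b and k = K])
      show "restr {v. crd v k = j} u \<in> R.partial_ideal (of_int d) p (k - 1)"
        if "u \<in> R.partial_ideal (of_int d) p (k - 1)" for j u
      proof -
        let ?S = "{v. crd v k = j}"
        obtain a v where a: "\<forall>i\<in>{1..k - 1}. a i \<in> ?R" and v: "v \<in> ?R"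
          and u: "u = (\<Sum>i=1..k - 1. a i * p i) + of_int d * v"
          using \<open>u \<in> _\<close> unfolding R.partial_ideal_def by blast
        \<comment> \<open>For \<open>i < k\<close> the entry \<open>p i\<close> has degree 0 in
          \<open>x k\<close>, so restricting to one degree acts on the coefficient alone.\<close>
        have "restr ?S (a i * p i) = restr ?S (a i) * p i" if i: "i \<in> {1..k - 1}" for i
        proof (rule restr_mult)
          fix m b assume m: "m \<in> Poly_Mapping.keys (a i)" and b: "b \<in> Poly_Mapping.keys (p i)"
          have "i \<in> {1..n}" using i k by auto
          then have b': "b \<in> int_span (k - 1) x" using keysp[of i] b int_span_mono[of i "k - 1" x] i by auto
          have "m \<in> L" using a m i unfolding group_ring_on_def by auto
          then have "crd (m + b) k = crd m k"
            using crd_add[OF _ subL[OF b'] k] crd_low[OF b' _ k] k by simp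
          then show "m + b \<in> ?S \<longleftrightarrow> m \<in> ?S" by simp
        qed
        moreover have "restr ?S (v * of_int d) = restr ?S v * of_int d"
          by (rule restr_mult) (auto simp: in_keys_iff lookup_of_int when_def split: if_splits)
        ultimately have "restr ?S u = (\<Sum>i=1..k - 1. restr ?S (a i) * p i) + of_int d * restr ?S v"
          unfolding u by (simp add: restr_add restr_sum mult.commute)
        moreover have "restr ?S w \<in> ?R" if "w \<in> ?R" for w
          using that by (auto simp: group_ring_on_def keys_restr)
        ultimately show ?thesis
          unfolding R.partial_ideal_def using a v
          by (intro CollectI exI[of _ "\<lambda>i. restr ?S (a i)"] exI[of _ "restr ?S v"]) auto
      qed
    qed (use L0 Ladd Luminus crd_add k low c crdk[OF mu] subL[OF mu] xL[OF k] R.ideal_partial_ideal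
         keysp[OF k] int_span_mono[of k n x] in \<open>auto simp: b_def group_ring_on_def L\<close>)
  qed
qed

section \<open>Root systems and exponential invariants\<close>

subsection \<open>Reflections and the Weyl group\<close>

lemma refl_root_inner: "refl_root a v \<bullet> u = v \<bullet> u - (2 * (v \<bullet> a) / (a \<bullet> a)) * (a \<bullet> u)"
  by (simp add: refl_root_def inner_diff_left)

lemma linear_refl_root: "linear (refl_root a)"
  by (rule linearI)
    (simp_all add: refl_root_def inner_add_left algebra_simps add_divide_distrib scaleR_add_left scaleR_diff_right)

lemma refl_root_invol: "a \<noteq> 0 \<Longrightarrow> refl_root a (refl_root a v) = v"
  by (simp add: refl_root_def inner_diff_left algebra_simps scaleR_add_left[symmetric] diff_divide_distrib)

lemma refl_root_sym: "refl_root a u \<bullet> v = u \<bullet> refl_root a v"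
  by (simp add: refl_root_def inner_diff_left inner_diff_right inner_commute)

lemma refl_root_orthogonal: "a \<noteq> 0 \<Longrightarrow> refl_root a u \<bullet> refl_root a v = u \<bullet> v"
  by (simp add: refl_root_sym refl_root_invol)

lemma refl_root_uminus: "refl_root (- a) = refl_root a"
  by (rule ext) (simp add: refl_root_def)

lemma refl_root_self: "a \<noteq> 0 \<Longrightarrow> refl_root a a = - a"
  by (simp add: refl_root_def scaleR_2)

text \<open>The conjugation rule for reflections, in the form that carries a reflection past a
  letter of a word.\<close>

lemma refl_root_conj: "a \<noteq> 0 \<Longrightarrow> refl_root b (refl_root a v) = refl_root a (refl_root (refl_root a b) v)"
  by (simp add: refl_root_def[of b] refl_root_def[of "refl_root a b"] refl_root_orthogonal
      linear_diff[OF linear_refl_root] linear_scale[OF linear_refl_root] refl_root_invol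
      flip: refl_root_sym)

section \<open>Simple roots, fundamental weights and positivity\<close>

locale root_sys =
  fixes Phi :: "(real^'n) set" and n :: nat and al om :: "nat \<Rightarrow> real^'n"
  assumes rs: "root_system Phi" and base: "is_base Phi n al" and fw: "fundamental_weights n al om"
begin

lemma finite_Phi: "finite Phi" and zero_notin: "0 \<notin> Phi" and span_Phi: "span Phi = UNIV"
  and refl_Phi: "a \<in> Phi \<Longrightarrow> refl_root a ` Phi = Phi"
  and cartan_int: "a \<in> Phi \<Longrightarrow> b \<in> Phi \<Longrightarrow> 2 * (b \<bullet> a) / (a \<bullet> a) \<in> \<int>"
  and reduced: "a \<in> Phi \<Longrightarrow> c *\<^sub>R a \<in> Phi \<Longrightarrow> c = 1 \<or> c = - 1"
  using rs unfolding root_system_def by auto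

lemma Phi_nonzero: "a \<in> Phi \<Longrightarrow> a \<noteq> 0"
  using zero_notin by auto

lemma refl_mem: "a \<in> Phi \<Longrightarrow> b \<in> Phi \<Longrightarrow> refl_root a b \<in> Phi"
  using refl_Phi by blast

lemma uminus_mem_Phi: "a \<in> Phi \<Longrightarrow> - a \<in> Phi"
  using refl_mem[of a a] refl_root_self[of a] Phi_nonzero[of a] by auto

lemma al_mem: "i \<in> {1..n} \<Longrightarrow> al i \<in> Phi"
  using base unfolding is_base_def by auto

lemma al_pos: "i \<in> {1..n} \<Longrightarrow> 0 < al i \<bullet> al i"
  using al_mem Phi_nonzero by auto

lemma al_nonzero: "i \<in> {1..n} \<Longrightarrow> al i \<noteq> 0"
  using al_mem Phi_nonzero by auto

lemma om_al: "i \<in> {1..n} \<Longrightarrow> j \<in> {1..n} \<Longrightarrow> om i \<bullet> al j = (if i = j then al j \<bullet> al j / 2 else 0)"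
  using fw[unfolded fundamental_weights_def, rule_format, of i j] al_pos[of j]
  by (auto simp: field_simps split: if_splits)

lemma sum_al_om: "j \<in> {1..n} \<Longrightarrow> (\<Sum>i=1..n. c i *\<^sub>R al i) \<bullet> om j = c j * (al j \<bullet> al j) / 2"
proof -
  assume j: "j \<in> {1..n}"
  have "(\<Sum>i=1..n. c i *\<^sub>R al i) \<bullet> om j = (\<Sum>i=1..n. if i = j then c j * (al j \<bullet> al j) / 2 else 0)"
    unfolding inner_sum_left using j by (intro sum.cong refl) (auto simp: inner_commute[of _ "om j"] om_al)
  then show ?thesis using j by simp
qed

lemma al_expansion: "v = (\<Sum>j=1..n. (2 * (v \<bullet> om j) / (al j \<bullet> al j)) *\<^sub>R al j)"
proof -
  have inj: "inj_on al {1..n}" and "span (al ` {1..n}) = UNIV" using base unfolding is_base_def by auto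
  then have "v \<in> range (\<lambda>u. \<Sum>b\<in>al ` {1..n}. u b *\<^sub>R b)"
    using span_finite[of "al ` {1..n}"] by simp
  then obtain u where "v = (\<Sum>b\<in>al ` {1..n}. u b *\<^sub>R b)" by auto
  then have v: "v = (\<Sum>j=1..n. u (al j) *\<^sub>R al j)" using inj by (simp add: sum.reindex)
  have ueq: "u (al j) = 2 * (v \<bullet> om j) / (al j \<bullet> al j)" if "j \<in> {1..n}" for j
    using sum_al_om[OF that, of "\<lambda>j. u (al j)", folded v] al_pos[OF that] by (simp add: field_simps)
  show ?thesis by (rule trans[OF v]) (intro sum.cong refl, simp only: ueq)
qed

lemma inner_al_zero: "(\<And>j. j \<in> {1..n} \<Longrightarrow> w \<bullet> al j = 0) \<Longrightarrow> w = 0"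
proof -
  assume *: "\<And>j. j \<in> {1..n} \<Longrightarrow> w \<bullet> al j = 0"
  have "w \<bullet> w = w \<bullet> (\<Sum>j=1..n. (2 * (w \<bullet> om j) / (al j \<bullet> al j)) *\<^sub>R al j)"
    by (rule arg_cong[where f = "\<lambda>u. w \<bullet> u", OF al_expansion])
  also have "\<dots> = 0" unfolding inner_sum_right using * by (intro sum.neutral) auto
  finally show ?thesis by simp
qed

lemma om_expansion: "v = (\<Sum>j=1..n. (2 * (v \<bullet> al j) / (al j \<bullet> al j)) *\<^sub>R om j)"
proof -
  let ?c = "\<lambda>j. 2 * (v \<bullet> al j) / (al j \<bullet> al j)"
  have "(v - (\<Sum>j=1..n. ?c j *\<^sub>R om j)) \<bullet> al i = 0" if i: "i \<in> {1..n}" for i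
  proof -
    have "(\<Sum>j=1..n. ?c j *\<^sub>R om j) \<bullet> al i = (\<Sum>j=1..n. if j = i then v \<bullet> al i else 0)"
      unfolding inner_sum_left using i al_pos[OF i] by (intro sum.cong refl) (auto simp: om_al)
    then show ?thesis using i by (simp add: inner_diff_left)
  qed
  then have "v - (\<Sum>j=1..n. ?c j *\<^sub>R om j) = 0" by (rule inner_al_zero)
  then show ?thesis by (simp only: right_minus_eq)
qed

text \<open>By \<open>al_expansion\<close> these inner products are, up to positive factors, the
  coefficients of \<open>v\<close> in the simple roots. So this is the cone of non-negative real
  combinations of simple roots, and \<open>cone (u - v)\<close> is the dominance order.\<close>

definition cone :: "real^'n \<Rightarrow> bool" where
  "cone v \<longleftrightarrow> (\<forall>j\<in>{1..n}. 0 \<le> v \<bullet> om j)"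

definition dom :: "real^'n \<Rightarrow> bool" where
  "dom v \<longleftrightarrow> (\<forall>j\<in>{1..n}. 0 \<le> v \<bullet> al j)"

lemma cone_add: "cone u \<Longrightarrow> cone v \<Longrightarrow> cone (u + v)"
  by (auto simp: cone_def inner_add_left)

lemma cone_scale: "0 \<le> c \<Longrightarrow> cone v \<Longrightarrow> cone (c *\<^sub>R v)"
  by (auto simp: cone_def)

lemma cone_al: "i \<in> {1..n} \<Longrightarrow> cone (al i)"
  unfolding cone_def
proof
  fix j assume "i \<in> {1..n}" "j \<in> {1..n}"
  then show "0 \<le> al i \<bullet> om j" using om_al[of j i] by (simp add: inner_commute[of "al i" "om j"])
qed

lemma cone_antisym: "cone v \<Longrightarrow> cone (- v) \<Longrightarrow> v = 0"
proof -
  assume "cone v" "cone (- v)"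
  then have "v \<bullet> om j = 0" if "j \<in> {1..n}" for j using that unfolding cone_def by force
  then have "(\<Sum>j=1..n. (2 * (v \<bullet> om j) / (al j \<bullet> al j)) *\<^sub>R al j) = 0" by (intro sum.neutral) auto
  then show "v = 0" by (rule trans[OF al_expansion])
qed

lemma dom_cone_inner: "dom u \<Longrightarrow> cone v \<Longrightarrow> 0 \<le> u \<bullet> v"
proof -
  assume u: "dom u" and v: "cone v"
  have "u \<bullet> v = u \<bullet> (\<Sum>j=1..n. (2 * (v \<bullet> om j) / (al j \<bullet> al j)) *\<^sub>R al j)"
    by (rule arg_cong[where f = "\<lambda>v. u \<bullet> v", OF al_expansion])
  also have "\<dots> = (\<Sum>j=1..n. (2 * (v \<bullet> om j) / (al j \<bullet> al j)) * (u \<bullet> al j))"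
    by (simp add: inner_sum_right)
  also have "\<dots> \<ge> 0" using u v al_pos unfolding dom_def cone_def
    by (intro sum_nonneg mult_nonneg_nonneg divide_nonneg_nonneg) (auto simp: less_imp_le)
  finally show ?thesis .
qed

lemma root_dichotomy: "b \<in> Phi \<Longrightarrow> cone b \<or> cone (- b)"
proof -
  assume "b \<in> Phi"
  then obtain c :: "nat \<Rightarrow> int" where b: "b = (\<Sum>i=1..n. of_int (c i) *\<^sub>R al i)"
    and c: "(\<forall>i\<in>{1..n}. c i \<ge> 0) \<or> (\<forall>i\<in>{1..n}. c i \<le> 0)"
    using base unfolding is_base_def by blast
  have bj: "b \<bullet> om j = of_int (c j) * (al j \<bullet> al j) / 2" if "j \<in> {1..n}" for j
    unfolding b using sum_al_om[OF that, of "\<lambda>i. of_int (c i)"] by simp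
  from c show ?thesis
  proof
    assume c: "\<forall>i\<in>{1..n}. c i \<ge> 0"
    have "0 \<le> b \<bullet> om j" if "j \<in> {1..n}" for j
      unfolding bj[OF that] using c that by simp
    then show ?thesis by (simp add: cone_def)
  next
    assume c: "\<forall>i\<in>{1..n}. c i \<le> 0"
    have "0 \<le> (- b) \<bullet> om j" if "j \<in> {1..n}" for j
      using c that by (simp add: bj[OF that] mult_nonpos_nonneg)
    then show ?thesis by (simp add: cone_def)
  qed
qed

text \<open>The reflection in \<open>al i\<close> changes only the coefficient of
  \<open>al i\<close>. As the root system is reduced, a positive root other than \<open>al i\<close>
  has another positive coefficient, and a root with one positive coefficient is positive.\<close>

lemma simple_refl_pos:
  assumes i: "i \<in> {1..n}" and b: "b \<in> Phi" "cone b" "b \<noteq> al i"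
  shows "cone (refl_root (al i) b)"
proof -
  have same: "refl_root (al i) b \<bullet> om j = b \<bullet> om j" if "j \<in> {1..n}" "j \<noteq> i" for j
    using om_al[OF that(1) i] that by (simp add: refl_root_inner inner_commute[of "al i" "om j"])
  have "\<exists>j\<in>{1..n}. j \<noteq> i \<and> 0 < b \<bullet> om j"
  proof (rule ccontr)
    assume neg: "\<not> ?thesis"
    have z: "b \<bullet> om j = 0" if "j \<in> {1..n}" "j \<noteq> i" for j
      using neg b(2) that unfolding cone_def by force
    define c where "c = 2 * (b \<bullet> om i) / (al i \<bullet> al i)"
    have "b = (\<Sum>j=1..n. if j = i then c *\<^sub>R al i else 0)"
      by (rule trans[OF al_expansion]) (intro sum.cong refl, auto simp: z c_def)
    then have bc: "b = c *\<^sub>R al i" using i by simp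
    then have "c = 1 \<or> c = - 1" using reduced[OF al_mem[OF i]] b(1) by simp
    moreover have "0 \<le> c" unfolding c_def using b(2) i al_pos[OF i] by (auto simp: cone_def)
    ultimately show False using bc b(3) by auto
  qed
  then obtain j where j: "j \<in> {1..n}" "j \<noteq> i" "0 < b \<bullet> om j" by blast
  then have "\<not> cone (- refl_root (al i) b)" using same[OF j(1,2)] unfolding cone_def by force
  then show ?thesis using root_dichotomy refl_mem[OF al_mem[OF i] b(1)] by blast
qed

section \<open>Words in the simple reflections\<close>

fun word :: "nat list \<Rightarrow> real^'n \<Rightarrow> real^'n" where
  "word [] v = v"
| "word (i # js) v = refl_root (al i) (word js v)"

lemma word_append: "word (is @ js) v = word is (word js v)"
  by (induction "is") auto

lemma word_rev: "set is \<subseteq> {1..n} \<Longrightarrow> word is u \<bullet> v = u \<bullet> word (rev is) v"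
  by (induction "is" arbitrary: v) (auto simp: refl_root_sym word_append)

lemma word_mem: "set is \<subseteq> {1..n} \<Longrightarrow> b \<in> Phi \<Longrightarrow> word is b \<in> Phi"
  by (induction "is") (auto intro!: refl_mem al_mem)

text \<open>The exchange condition: if \<open>word js\<close> has the positive root \<open>b\<close> as an inversion, composing with
  the reflection in \<open>b\<close> shortens the word.\<close>
lemma word_exchange:
  assumes "set js \<subseteq> {1..n}" "b \<in> Phi" "cone b" "cone (- word (rev js) b)"
  shows "\<exists>js'. set js' \<subseteq> {1..n} \<and> length js' < length js \<and> (\<forall>v. refl_root b (word js v) = word js' v)"
  using assms
proof (induction js arbitrary: b)
  case Nil
  then have "b = 0" using cone_antisym by simp
  then show ?case using Nil zero_notin by simp
next
  case (Cons k ks)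
  then have k: "k \<in> {1..n}" and ks: "set ks \<subseteq> {1..n}" by auto
  show ?case
  \<comment> \<open>If \<open>b\<close> is the first letter's own root, that letter cancels.
    Otherwise the reflection is moved past the letter and becomes the reflection in
    \<open>refl_root (al k) b\<close>, which is still positive.\<close>
  proof (cases "b = al k")
    case True
    then show ?thesis using ks al_nonzero[OF k] by (intro exI[of _ ks]) (auto simp: refl_root_invol)
  next
    case False
    let ?b = "refl_root (al k) b"
    have "cone ?b" using simple_refl_pos[OF k] Cons.prems False by blast
    moreover have "?b \<in> Phi" using refl_mem[OF al_mem[OF k]] Cons.prems by blast
    moreover have "cone (- word (rev ks) ?b)" using Cons.prems(4) by (simp add: word_append)
    ultimately obtain ks' where ks': "set ks' \<subseteq> {1..n}" "length ks' < length ks"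
      "\<forall>v. refl_root ?b (word ks v) = word ks' v" using Cons.IH[OF ks] by blast
    then show ?thesis
      using k al_nonzero[OF k] by (intro exI[of _ "k # ks'"]) (auto simp: refl_root_conj[of "al k" b])
  qed
qed

text \<open>A positive root that is not simple is lowered in height by some simple reflection and
  stays positive. The induction counts the roots of smaller height; both conclusions are transported
  back by conjugation.\<close>

lemma pos_root_word:
  assumes "b \<in> Phi" "cone b"
  shows "(\<exists>js. set js \<subseteq> {1..n} \<and> (\<forall>v. refl_root b v = word js v))
    \<and> (\<exists>js i. set js \<subseteq> {1..n} \<and> i \<in> {1..n} \<and> b = word js (al i))"
  using assms
proof (induction "card {g \<in> Phi. (\<Sum>j=1..n. 2 * (g \<bullet> om j) / (al j \<bullet> al j)) < (\<Sum>j=1..n. 2 * (b \<bullet> om j) / (al j \<bullet> al j))}"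
    arbitrary: b rule: less_induct)
  case less
  define h where "h v = (\<Sum>j=1..n. 2 * (v \<bullet> om j) / (al j \<bullet> al j))" for v
  show ?case
  proof (cases "\<exists>i\<in>{1..n}. b = al i")
    case True
    then obtain i where "i \<in> {1..n}" "b = al i" by blast
    then show ?thesis by (intro conjI exI[of _ "[i]"] exI[of _ "[]"] exI[of _ i]) auto
  next
    case False
    \<comment> \<open>Otherwise \<open>- b\<close> would be dominant, and pairing it with the
      positive \<open>b\<close> would give \<open>b \<bullet> b \<le> 0\<close>.\<close>
    have "\<exists>i\<in>{1..n}. 0 < b \<bullet> al i"
    proof (rule ccontr)
      assume neg: "\<not> ?thesis"
      have "dom (- b)" using neg by (auto simp: dom_def not_less)
      then have "b \<bullet> b \<le> 0" using dom_cone_inner[of "- b" b] less.prems by simp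
      then show False using Phi_nonzero[OF less.prems(1)] by (metis inner_gt_zero_iff not_less)
    qed
    then obtain i where i: "i \<in> {1..n}" "0 < b \<bullet> al i" by blast
    let ?b = "refl_root (al i) b"
    have b': "?b \<in> Phi" "cone ?b"
      using refl_mem[OF al_mem[OF i(1)] less.prems(1)] simple_refl_pos[OF i(1) less.prems] False i by auto
    have "h ?b < h b"
      unfolding h_def
    proof (rule sum_strict_mono_ex1)
      let ?c = "2 * (b \<bullet> al i) / (al i \<bullet> al i)"
      have c: "0 < ?c" using i al_pos[OF i(1)] by simp
      show "\<forall>j\<in>{1..n}. 2 * (?b \<bullet> om j) / (al j \<bullet> al j) \<le> 2 * (b \<bullet> om j) / (al j \<bullet> al j)"
      proof
        fix j assume j: "j \<in> {1..n}"
        have "0 \<le> al i \<bullet> om j" using cone_al[OF i(1)] j by (simp add: cone_def)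
        then have "0 \<le> ?c * (al i \<bullet> om j)" using c by (intro mult_nonneg_nonneg) linarith+
        then have "?b \<bullet> om j \<le> b \<bullet> om j" by (simp add: refl_root_inner)
        then show "2 * (?b \<bullet> om j) / (al j \<bullet> al j) \<le> 2 * (b \<bullet> om j) / (al j \<bullet> al j)"
          by (intro divide_right_mono) auto
      qed
      show "\<exists>j\<in>{1..n}. 2 * (?b \<bullet> om j) / (al j \<bullet> al j) < 2 * (b \<bullet> om j) / (al j \<bullet> al j)"
      proof (intro bexI[of _ i] i(1))
        have "0 < al i \<bullet> om i" using al_pos[OF i(1)] unfolding inner_commute[of "al i" "om i"] om_al[OF i(1) i(1)] by simp
        then have "0 < ?c * (al i \<bullet> om i)" using c by (rule mult_pos_pos[rotated])
        then have "?b \<bullet> om i < b \<bullet> om i" by (simp add: refl_root_inner)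
        then show "2 * (?b \<bullet> om i) / (al i \<bullet> al i) < 2 * (b \<bullet> om i) / (al i \<bullet> al i)"
          using al_pos[OF i(1)] by (intro divide_strict_right_mono) auto
      qed
    qed simp
    then have "card {g \<in> Phi. h g < h ?b} < card {g \<in> Phi. h g < h b}"
      using b' finite_Phi by (intro psubset_card_mono) auto
    then obtain js ks k where js: "set js \<subseteq> {1..n}" "\<forall>v. refl_root ?b v = word js v"
      and ks: "set ks \<subseteq> {1..n}" "k \<in> {1..n}" "?b = word ks (al k)"
      using less.hyps[of ?b] b' unfolding h_def by blast
    have "b = word (i # ks) (al k)" using ks refl_root_invol[OF al_nonzero[OF i(1)], of b] by simp
    moreover have "refl_root b v = word (i # js @ [i]) v" for v
      using refl_root_conj[OF al_nonzero[OF i(1)], of b "refl_root (al i) v"] js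
      by (simp add: refl_root_invol[OF al_nonzero[OF i(1)]] word_append)
    ultimately show ?thesis
      using i js ks by (intro conjI exI[of _ "i # js @ [i]"] exI[of _ "i # ks"] exI[of _ k]) auto
  qed
qed

lemma weyl_word: "w \<in> weyl_group Phi \<Longrightarrow> \<exists>js. set js \<subseteq> {1..n} \<and> (\<forall>v. w v = word js v)"
proof (induction rule: weyl_group.induct)
  case id
  show ?case by (intro exI[of _ "[]"]) auto
next
  case (step w a)
  then obtain js where js: "set js \<subseteq> {1..n}" "\<forall>v. w v = word js v" by blast
  have "\<exists>is. set is \<subseteq> {1..n} \<and> (\<forall>v. refl_root a v = word is v)"
    using root_dichotomy[OF step.hyps(2)] pos_root_word[OF step.hyps(2)]
      pos_root_word[OF uminus_mem_Phi[OF step.hyps(2)]] by (auto simp: refl_root_uminus)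
  then obtain "is" where "set is \<subseteq> {1..n}" "\<forall>v. refl_root a v = word is v" by blast
  then show ?case using js by (intro exI[of _ "is @ js"]) (auto simp: word_append)
qed

text \<open>If the rest of the word carries \<open>al i\<close> back to a positive root, the first
  letter subtracts a non-negative multiple of \<open>al i\<close>. If it carries \<open>al i\<close>
  to a negative root, the exchange condition supplies a shorter word with the same action.\<close>

lemma dom_minus_word_cone:
  assumes "dom u" "set js \<subseteq> {1..n}"
  shows "cone (u - word js u)"
  using assms(2)
proof (induction "length js" arbitrary: js rule: less_induct)
  case less
  show ?case
  proof (cases js)
    case Nil
    then show ?thesis by (simp add: cone_def)
  next
    case (Cons i ks)
    then have i: "i \<in> {1..n}" and ks: "set ks \<subseteq> {1..n}" using less.prems by auto
    have "word (rev ks) (al i) \<in> Phi" using word_mem[of "rev ks"] ks al_mem[OF i] by simp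
    then consider "cone (word (rev ks) (al i))" | "cone (- word (rev ks) (al i))"
      using root_dichotomy by blast
    then show ?thesis
    proof cases
      case 1
      have "0 \<le> word ks u \<bullet> al i" using dom_cone_inner[OF assms(1) 1] word_rev[OF ks] by simp
      then have "cone ((2 * (word ks u \<bullet> al i) / (al i \<bullet> al i)) *\<^sub>R al i)"
        using cone_al[OF i] by (intro cone_scale) auto
      then have "cone ((u - word ks u) + (2 * (word ks u \<bullet> al i) / (al i \<bullet> al i)) *\<^sub>R al i)"
        using less.hyps[of ks] Cons ks by (intro cone_add) auto
      then show ?thesis by (simp add: Cons refl_root_def algebra_simps)
    next
      case 2
      then obtain js' where "set js' \<subseteq> {1..n}" "length js' < length ks"
        "\<forall>v. refl_root (al i) (word ks v) = word js' v"
        using word_exchange[OF ks al_mem[OF i] cone_al[OF i]] by blast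
      then show ?thesis using less.hyps[of js'] Cons by simp
    qed
  qed
qed

lemma dom_minus_weyl_cone: "dom u \<Longrightarrow> w \<in> weyl_group Phi \<Longrightarrow> cone (u - w u)"
  using weyl_word dom_minus_word_cone by metis

end

subsection \<open>Orbit sums\<close>

lemma augmentation_superset:
  assumes "finite S" "Poly_Mapping.keys p \<subseteq> S"
  shows "augmentation p = (\<Sum>l\<in>S. Poly_Mapping.lookup p l)"
  unfolding augmentation_def using assms by (intro sum.mono_neutral_left) (auto simp: in_keys_iff)

lemma augmentation_add: "augmentation (p + q) = augmentation p + augmentation q"
proof -
  let ?S = "Poly_Mapping.keys p \<union> Poly_Mapping.keys q"
  have "augmentation (p + q) = (\<Sum>l\<in>?S. Poly_Mapping.lookup (p + q) l)"
    using Poly_Mapping.keys_add[of p q] by (intro augmentation_superset) auto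
  also have "\<dots> = augmentation p + augmentation q"
    using augmentation_superset[of ?S p] augmentation_superset[of ?S q]
    by (simp add: lookup_add sum.distrib)
  finally show ?thesis .
qed

lemma augmentation_zero [simp]: "augmentation 0 = 0"
  by (simp add: augmentation_def)

lemma augmentation_sum: "augmentation (sum f I) = (\<Sum>i\<in>I. augmentation (f i))"
  by (induction I rule: infinite_finite_induct) (simp_all add: augmentation_add)

lemma augmentation_single [simp]: "augmentation (Poly_Mapping.single k c) = c"
  by (simp add: augmentation_def)

lemma augmentation_mult:
  "augmentation (p * q) = augmentation p * augmentation (q :: ('n::finite) grp_ring)"
proof -
  let ?m = "\<lambda>p k. Poly_Mapping.single k (Poly_Mapping.lookup p k)"
  have "augmentation (p * q)
      = augmentation ((\<Sum>m\<in>Poly_Mapping.keys p. ?m p m) * (\<Sum>b\<in>Poly_Mapping.keys q. ?m q b))"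
    by (simp add: sum_monomials)
  also have "\<dots> = (\<Sum>m\<in>Poly_Mapping.keys p. \<Sum>b\<in>Poly_Mapping.keys q. augmentation (?m p m * ?m q b))"
    by (simp add: sum_product augmentation_sum)
  also have "\<dots> = augmentation p * augmentation q"
    by (simp add: mult_single) (simp add: augmentation_def sum_product)
  finally show ?thesis .
qed

lemma augmentation_of_int [simp]: "augmentation (of_int c :: ('n::finite) grp_ring) = c"
proof -
  have "augmentation (of_int c :: 'n grp_ring) = (\<Sum>l\<in>{0}. Poly_Mapping.lookup (of_int c :: 'n grp_ring) l)"
    by (intro augmentation_superset) (auto simp: in_keys_iff lookup_of_int when_def split: if_splits)
  then show ?thesis by (simp add: lookup_of_int)
qed

lemma augmentation_diff: "augmentation (p - q) = augmentation p - augmentation q"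
  using augmentation_add[of "p - q" q] by simp

lemma weyl_comp: "w \<in> weyl_group Phi \<Longrightarrow> w' \<in> weyl_group Phi \<Longrightarrow> w \<circ> w' \<in> weyl_group Phi"
  by (induction rule: weyl_group.induct) (auto simp: comp_assoc intro: weyl_group.step)

lemma weyl_linear: "w \<in> weyl_group Phi \<Longrightarrow> linear w"
  by (induction rule: weyl_group.induct) (use linear_id linear_compose linear_refl_root in blast)+

lemma orbit_self: "v \<in> orbit Phi v"
  unfolding orbit_def using weyl_group.id[of Phi] by (metis (mono_tags, lifting) id_apply mem_Collect_eq)

lemma orbit_weyl: "m \<in> orbit Phi v \<Longrightarrow> w \<in> weyl_group Phi \<Longrightarrow> w m \<in> orbit Phi v"
proof -
  assume "m \<in> orbit Phi v" and w: "w \<in> weyl_group Phi"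
  then obtain w' where "w' \<in> weyl_group Phi" "m = w' v" unfolding orbit_def by blast
  then have "w \<circ> w' \<in> weyl_group Phi" "w m = (w \<circ> w') v" using weyl_comp[OF w] by auto
  then show ?thesis unfolding orbit_def by blast
qed

section \<open>Finiteness of the Weyl group and dominant representatives\<close>

context root_sys
begin

lemma refl_weyl: "a \<in> Phi \<Longrightarrow> refl_root a \<in> weyl_group Phi"
  using weyl_group.step[OF weyl_group.id, of a Phi] by simp

lemma weyl_inv: "w \<in> weyl_group Phi \<Longrightarrow> \<exists>w'\<in>weyl_group Phi. (\<forall>v. w' (w v) = v) \<and> (\<forall>v. w (w' v) = v)"
proof (induction rule: weyl_group.induct)
  case id
  show ?case by (intro bexI[of _ id]) (auto intro: weyl_group.id)
next
  case (step w a)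
  then obtain w' where w': "w' \<in> weyl_group Phi" "\<forall>v. w' (w v) = v" "\<forall>v. w (w' v) = v" by blast
  show ?case
    using w' weyl_comp[OF w'(1) refl_weyl[OF step.hyps(2)]] refl_root_invol[OF Phi_nonzero[OF step.hyps(2)]]
    by (intro bexI[of _ "w' \<circ> refl_root a"]) auto
qed

lemma orbit_eq: "m \<in> orbit Phi v \<Longrightarrow> orbit Phi m = orbit Phi v"
proof -
  assume m: "m \<in> orbit Phi v"
  then obtain w where w: "w \<in> weyl_group Phi" "m = w v" unfolding orbit_def by blast
  obtain w' where w': "w' \<in> weyl_group Phi" "w' (w v) = v" using weyl_inv[OF w(1)] by blast
  then have v: "v \<in> orbit Phi m" unfolding orbit_def w(2) by (auto intro!: exI[of _ w'])
  have "orbit Phi a \<subseteq> orbit Phi b" if "a \<in> orbit Phi b" for a b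
    using orbit_weyl[OF that] unfolding orbit_def[of _ a] by blast
  then show ?thesis using m v by blast
qed

lemma weyl_orbit_iff: "w \<in> weyl_group Phi \<Longrightarrow> w m \<in> orbit Phi v \<longleftrightarrow> m \<in> orbit Phi v"
  using weyl_inv[of w] orbit_weyl by metis

lemma weyl_Phi: "w \<in> weyl_group Phi \<Longrightarrow> b \<in> Phi \<Longrightarrow> w b \<in> Phi"
  by (induction rule: weyl_group.induct) (auto intro: refl_mem)

text \<open>Weyl group elements are linear and the roots span, so each is determined by its action
  on the finite set \<open>Phi\<close>.\<close>

lemma finite_weyl: "finite (weyl_group Phi)"
proof (rule finite_imageD)
  show "finite ((\<lambda>w. restrict w Phi) ` weyl_group Phi)"
    by (rule finite_subset[of _ "Phi \<rightarrow>\<^sub>E Phi"]) (auto intro: weyl_Phi finite_PiE simp: finite_Phi)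
  show "inj_on (\<lambda>w. restrict w Phi) (weyl_group Phi)"
  proof (rule inj_onI)
    fix w w' assume w: "w \<in> weyl_group Phi" "w' \<in> weyl_group Phi" and eq: "restrict w Phi = restrict w' Phi"
    have "w b = w' b" if "b \<in> Phi" for b using fun_cong[OF eq, of b] that by simp
    then have "w v = w' v" for v
      using linear_eq_on[OF weyl_linear[OF w(1)] weyl_linear[OF w(2)], of v Phi] span_Phi by blast
    then show "w = w'" by blast
  qed
qed

lemma finite_orbit: "finite (orbit Phi v)"
proof -
  have "orbit Phi v = (\<lambda>w. w v) ` weyl_group Phi" unfolding orbit_def by blast
  then show ?thesis using finite_weyl by simp
qed

text \<open>The vector \<open>de\<close> is strictly dominant. An orbit element with the largest
  pairing against it is dominant, because a simple reflection at a negative coordinate would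
  increase that pairing.\<close>

lemma ex_dom: "\<exists>m\<in>orbit Phi v. dom m"
proof -
  define de where "de = (\<Sum>j=1..n. om j)"
  have de: "0 < al i \<bullet> de" if i: "i \<in> {1..n}" for i
  proof -
    have "al i \<bullet> de = (\<Sum>j=1..n. if j = i then al i \<bullet> al i / 2 else 0)"
      unfolding de_def inner_sum_right using i
      by (intro sum.cong refl) (simp add: inner_commute[of "al i" "om _"] om_al)
    then have "al i \<bullet> de = al i \<bullet> al i / 2" using i by simp
    then show ?thesis using al_pos[OF i] by linarith
  qed
  have ne: "orbit Phi v \<noteq> {}" using orbit_self by blast
  obtain m where m: "m \<in> orbit Phi v" "\<And>u. u \<in> orbit Phi v \<Longrightarrow> u \<bullet> de \<le> m \<bullet> de"
  proof -
    let ?M = "Max ((\<lambda>u. u \<bullet> de) ` orbit Phi v)"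
    have "?M \<in> (\<lambda>u. u \<bullet> de) ` orbit Phi v" using finite_orbit ne by (intro Max_in) auto
    then obtain m where "m \<in> orbit Phi v" "m \<bullet> de = ?M" by auto
    then show thesis using finite_orbit by (intro that[of m]) (auto intro!: Max_ge)
  qed
  have "0 \<le> m \<bullet> al i" if i: "i \<in> {1..n}" for i
  proof -
    have "refl_root (al i) m \<bullet> de \<le> m \<bullet> de" using m orbit_weyl[OF m(1) refl_weyl[OF al_mem[OF i]]] by blast
    then have "0 \<le> (2 * (m \<bullet> al i) / (al i \<bullet> al i)) * (al i \<bullet> de)" by (simp add: refl_root_inner)
    then have "0 \<le> 2 * (m \<bullet> al i) / (al i \<bullet> al i)" using de[OF i] by (simp only: zero_le_mult_iff) linarith
    then show ?thesis using al_pos[OF i] by (simp add: zero_le_divide_iff)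
  qed
  then show ?thesis using m(1) unfolding dom_def by blast
qed

lemma dom_orbit_cone: "dom u \<Longrightarrow> m \<in> orbit Phi u \<Longrightarrow> cone (u - m)"
  unfolding orbit_def using dom_minus_weyl_cone by blast

text \<open>The pairing of \<open>v\<close> with the coroot of \<open>b\<close>.\<close>

definition pr :: "real^'n \<Rightarrow> real^'n \<Rightarrow> real" where
  "pr v b = 2 * (v \<bullet> b) / (b \<bullet> b)"

lemma pr_add: "pr (u + v) b = pr u b + pr v b"
  by (simp add: pr_def inner_add_left add_divide_distrib)

lemma pr_scale: "pr (c *\<^sub>R v) b = c * pr v b"
  by (simp add: pr_def)

lemma pr_refl: "a \<in> Phi \<Longrightarrow> pr (refl_root a v) (refl_root a b) = pr v b"
  by (simp add: pr_def refl_root_orthogonal Phi_nonzero)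

text \<open>A Weyl-invariant form that, unlike the ambient inner product, is integral on the weight
  lattice, so that its values can serve as an induction measure.\<close>
definition Bf :: "real^'n \<Rightarrow> real^'n \<Rightarrow> real" where
  "Bf u v = (\<Sum>b\<in>Phi. pr u b * pr v b)"

lemma Bf_sym: "Bf u v = Bf v u"
  by (simp add: Bf_def mult.commute)

lemma Bf_add: "Bf (u + v) w = Bf u w + Bf v w"
  by (simp add: Bf_def pr_add distrib_right sum.distrib)

lemma Bf_square_add: "Bf (u + v) (u + v) = Bf u u + 2 * Bf u v + Bf v v"
  by (simp add: Bf_def pr_add algebra_simps sum.distrib sum_distrib_left)

lemma Bf_scale: "Bf (c *\<^sub>R v) w = c * Bf v w"
  by (simp add: Bf_def pr_scale sum_distrib_left mult.assoc)

lemma Bf_sum: "Bf (\<Sum>i\<in>I. f i) w = (\<Sum>i\<in>I. Bf (f i) w)"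
proof (induction I rule: infinite_finite_induct)
  case empty
  show ?case by (simp add: Bf_def pr_def)
next
  case (infinite A)
  then show ?case by (simp add: Bf_def pr_def)
qed (simp add: Bf_add)

lemma Bf_refl: "a \<in> Phi \<Longrightarrow> Bf (refl_root a u) (refl_root a v) = Bf u v"
proof -
  assume a: "a \<in> Phi"
  have inj: "inj_on (refl_root a) Phi"
    by (rule inj_on_inverseI[of _ "refl_root a"]) (simp add: refl_root_invol Phi_nonzero[OF a])
  have "Bf (refl_root a u) (refl_root a v)
      = (\<Sum>b\<in>refl_root a ` Phi. pr (refl_root a u) b * pr (refl_root a v) b)"
    unfolding Bf_def refl_Phi[OF a] ..
  also have "\<dots> = Bf u v" unfolding Bf_def using inj by (simp add: sum.reindex pr_refl[OF a])
  finally show ?thesis .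
qed

lemma Bf_orbit: "m \<in> orbit Phi v \<Longrightarrow> Bf m m = Bf v v"
proof -
  have "Bf (w v) (w v) = Bf v v" if "w \<in> weyl_group Phi" for w
    using that by (induction rule: weyl_group.induct) (auto simp: Bf_refl)
  then show "m \<in> orbit Phi v \<Longrightarrow> Bf m m = Bf v v" unfolding orbit_def by blast
qed

lemma Bf_pos: "v \<noteq> 0 \<Longrightarrow> 0 < Bf v v"
proof -
  assume "v \<noteq> 0"
  then obtain j where j: "j \<in> {1..n}" "v \<bullet> al j \<noteq> 0" using inner_al_zero by blast
  then have "pr v (al j) \<noteq> 0" using al_nonzero by (simp add: pr_def)
  then show ?thesis unfolding Bf_def using finite_Phi al_mem[OF j(1)]
    by (intro sum_pos2[of _ "al j"]) (auto simp: zero_less_mult_iff neq_iff)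
qed

lemma Bf_nonneg: "0 \<le> Bf v v"
  unfolding Bf_def by (intro sum_nonneg) auto

text \<open>Invariance under the reflection in \<open>al i\<close>, which negates
  \<open>al i\<close>, yields
  \<open>2 * Bf (al i) m = pr m (al i) * Bf (al i) (al i)\<close>.\<close>

lemma Bf_al_dom: "i \<in> {1..n} \<Longrightarrow> dom m \<Longrightarrow> 0 \<le> Bf (al i) m"
proof -
  assume i: "i \<in> {1..n}" and m: "dom m"
  have "Bf (al i) m = Bf (refl_root (al i) (al i)) (refl_root (al i) m)"
    by (simp add: Bf_refl[OF al_mem[OF i]])
  also have "\<dots> = Bf ((-1) *\<^sub>R al i) (m + (- pr m (al i)) *\<^sub>R al i)"
    using al_nonzero[OF i] by (simp add: refl_root_self) (simp add: refl_root_def pr_def)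
  also have "\<dots> = (-1) * (Bf m (al i) + (- pr m (al i)) * Bf (al i) (al i))"
    by (subst Bf_scale, subst Bf_sym, subst Bf_add, subst Bf_scale) (rule refl)
  also have "Bf m (al i) = Bf (al i) m" by (rule Bf_sym)
  finally have "2 * Bf (al i) m = pr m (al i) * Bf (al i) (al i)" by simp
  moreover have "0 \<le> pr m (al i)" using m i al_pos[OF i] by (simp add: pr_def dom_def)
  ultimately show ?thesis using Bf_nonneg[of "al i"] by (metis mult_nonneg_nonneg zero_le_mult_iff zero_less_numeral linorder_not_le)
qed

lemma Bf_cone_dom: "cone v \<Longrightarrow> dom m \<Longrightarrow> 0 \<le> Bf v m"
proof -
  assume v: "cone v" and m: "dom m"
  have "Bf v m = Bf (\<Sum>j=1..n. (2 * (v \<bullet> om j) / (al j \<bullet> al j)) *\<^sub>R al j) m"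
    by (rule arg_cong[where f = "\<lambda>v. Bf v m", OF al_expansion])
  also have "\<dots> \<ge> 0" unfolding Bf_sum Bf_scale
    using v al_pos Bf_al_dom[OF _ m] unfolding cone_def
    by (intro sum_nonneg mult_nonneg_nonneg divide_nonneg_nonneg) (auto simp: less_imp_le)
  finally show ?thesis .
qed

lemma Bf_dom_dom: "dom u \<Longrightarrow> dom v \<Longrightarrow> 0 \<le> Bf u v"
  unfolding Bf_def
proof (rule sum_nonneg)
  fix b assume "dom u" "dom v" "b \<in> Phi"
  then show "0 \<le> pr u b * pr v b"
    using root_dichotomy[of b] dom_cone_inner[of u b] dom_cone_inner[of v b]
      dom_cone_inner[of u "- b"] dom_cone_inner[of v "- b"]
    by (auto simp: pr_def mult_nonneg_nonneg mult_nonpos_nonpos)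
qed

text \<open>Expanding \<open>Bf\<close> at \<open>u = (u - m) + m\<close>, the square of
  \<open>u - m\<close> is positive and the mixed term is non-negative. This makes \<open>Bf\<close>
  decrease along the dominance order.\<close>

lemma Bf_less: "dom m \<Longrightarrow> cone (u - m) \<Longrightarrow> u \<noteq> m \<Longrightarrow> Bf m m < Bf u u"
proof -
  assume "dom m" "cone (u - m)" "u \<noteq> m"
  then have "0 < Bf (u - m) (u - m)" "0 \<le> Bf (u - m) m" by (auto intro: Bf_pos Bf_cone_dom)
  moreover have "Bf ((u - m) + m) ((u - m) + m) = Bf (u - m) (u - m) + 2 * Bf (u - m) m + Bf m m"
    by (rule Bf_square_add)
  ultimately show ?thesis by simp
qed

section \<open>The weight lattice\<close>

abbreviation "La \<equiv> weight_lattice Phi"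

lemma La_iff: "v \<in> La \<longleftrightarrow> (\<forall>b\<in>Phi. pr v b \<in> \<int>)"
  by (simp add: weight_lattice_def pr_def)

lemma La_zero: "0 \<in> La" and La_add: "u \<in> La \<Longrightarrow> v \<in> La \<Longrightarrow> u + v \<in> La" and La_uminus: "u \<in> La \<Longrightarrow> - u \<in> La"
  by (auto simp: La_iff pr_add) (auto simp: pr_def)

lemma La_refl: "a \<in> Phi \<Longrightarrow> v \<in> La \<Longrightarrow> refl_root a v \<in> La"
proof -
  assume a: "a \<in> Phi" and v: "v \<in> La"
  have "pr (refl_root a v) b \<in> \<int>" if b: "b \<in> Phi" for b
    using v refl_mem[OF a b] pr_refl[OF a, of v "refl_root a b"] refl_root_invol[OF Phi_nonzero[OF a], of b]
    by (auto simp: La_iff)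
  then show ?thesis by (simp add: La_iff)
qed

lemma La_orbit: "v \<in> La \<Longrightarrow> m \<in> orbit Phi v \<Longrightarrow> m \<in> La"
proof -
  assume v: "v \<in> La"
  have "w v \<in> La" if "w \<in> weyl_group Phi" for w
    using that v by (induction rule: weyl_group.induct) (auto intro: La_refl)
  then show "m \<in> orbit Phi v \<Longrightarrow> m \<in> La" unfolding orbit_def by blast
qed

text \<open>Integrality against simple coroots is preserved by simple reflections, the Cartan
  numbers being integers. A positive root is moved to a simple one by a word, and the word is
  transferred to \<open>om i\<close> by adjunction.\<close>

lemma om_La: "i \<in> {1..n} \<Longrightarrow> om i \<in> La"
proof -
  assume i: "i \<in> {1..n}"
  have word_int: "\<forall>k\<in>{1..n}. pr (word js (om i)) (al k) \<in> \<int>" if "set js \<subseteq> {1..n}" for js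
    using that
  proof (induction js)
    case Nil
    show ?case using i al_pos by (auto simp: pr_def om_al)
  next
    case (Cons j js)
    then have j: "j \<in> {1..n}" by simp
    let ?v = "word js (om i)"
    have "word (j # js) (om i) = ?v + (- pr ?v (al j)) *\<^sub>R al j" by (simp add: refl_root_def pr_def)
    moreover have "pr (al j) (al k) \<in> \<int>" if "k \<in> {1..n}" for k
      using cartan_int[OF al_mem al_mem] that j by (simp add: pr_def)
    moreover have "pr ?v (al k) \<in> \<int>" if "k \<in> {1..n}" for k using Cons that by simp
    ultimately show ?case using j by (auto simp only: pr_add pr_scale intro!: Ints_add Ints_mult Ints_minus)
  qed
  have pos: "pr (om i) b \<in> \<int>" if b: "b \<in> Phi" "cone b" for b
  proof -
    obtain js k where js: "set js \<subseteq> {1..n}" "k \<in> {1..n}" "b = word js (al k)"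
      using pos_root_word[OF b] by blast
    have rev: "word (rev js) (word js v) = v" for v
      using js(1) by (induction js) (auto simp: word_append refl_root_invol al_nonzero)
    have "b \<bullet> b = al k \<bullet> al k" using word_rev[OF js(1), of "al k" b] rev by (simp add: js(3))
    moreover have "om i \<bullet> b = word (rev js) (om i) \<bullet> al k"
      using word_rev[of "rev js" "om i" "al k"] js by simp
    ultimately have "pr (om i) b = pr (word (rev js) (om i)) (al k)" by (simp add: pr_def)
    then show ?thesis using word_int[of "rev js"] js by simp
  qed
  have "pr (om i) b \<in> \<int>" if b: "b \<in> Phi" for b
  proof (cases "cone b")
    case False
    then have "pr (om i) (- b) \<in> \<int>" using pos[OF uminus_mem_Phi[OF b]] root_dichotomy[OF b] by blast
    moreover have "pr (om i) (- b) = - pr (om i) b" by (simp add: pr_def)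
    ultimately show ?thesis by simp
  qed (use pos b in blast)
  then show ?thesis by (simp add: La_iff)
qed

lemma Bf_int: "v \<in> La \<Longrightarrow> Bf v v \<in> \<int>"
  unfolding Bf_def La_iff by (auto intro: Ints_sum)

lemma Bf_nat_less: "u \<in> La \<Longrightarrow> v \<in> La \<Longrightarrow> Bf u u < Bf v v \<Longrightarrow> nat \<lfloor>Bf u u\<rfloor> < nat \<lfloor>Bf v v\<rfloor>"
  using Bf_int[of u] Bf_int[of v] Bf_nonneg[of u] by (auto elim!: Ints_cases)

section \<open>Orbit sums, their products, and invariants modulo an ideal\<close>

lemma lookup_rho: "Poly_Mapping.lookup (rho Phi l) k = (if k \<in> orbit Phi l then 1 else 0)"
  unfolding rho_def lookup_sum lookup_single when_def using finite_orbit by simp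

lemma rho_orbit: "m \<in> orbit Phi l \<Longrightarrow> rho Phi m = rho Phi l"
  by (simp add: rho_def orbit_eq)

lemma augmentation_rho: "augmentation (rho Phi l) = int (card (orbit Phi l))"
  by (simp add: rho_def augmentation_sum)

lemma W_invariant_rho: "W_invariant Phi (rho Phi l)"
  by (simp add: W_invariant_def lookup_rho weyl_orbit_iff)

lemma keys_rho: "Poly_Mapping.keys (rho Phi l) = orbit Phi l"
  by (auto simp: in_keys_iff lookup_rho split: if_splits)

lemma csubring_La: "csubring (group_ring_on La)"
  by (rule csubring_group_ring[OF La_zero La_add])

lemma rho_La: "l \<in> La \<Longrightarrow> rho Phi l \<in> group_ring_on La"
  using La_orbit by (auto simp: group_ring_on_def keys_rho)

lemma lookup_rho_mult:
  "Poly_Mapping.lookup (rho Phi k * rho Phi l) m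
    = (\<Sum>(u, v)\<in>orbit Phi k \<times> orbit Phi l. if u + v = m then 1 else 0)"
  unfolding rho_def sum_product sum.cartesian_product
  by (simp add: mult_single lookup_sum lookup_single when_def split_def eq_commute)

lemma W_invariant_rho_mult: "W_invariant Phi (rho Phi k * rho Phi l)"
  unfolding W_invariant_def
proof (intro ballI allI)
  fix w m assume w: "w \<in> weyl_group Phi"
  obtain w' where w': "w' \<in> weyl_group Phi" "\<And>v. w' (w v) = v" "\<And>v. w (w' v) = v" using weyl_inv[OF w] by blast
  show "Poly_Mapping.lookup (rho Phi k * rho Phi l) (w m) = Poly_Mapping.lookup (rho Phi k * rho Phi l) m"
    unfolding lookup_rho_mult
  proof (rule sum.reindex_bij_witness[of _ "map_prod w w" "map_prod w' w'"])
    fix p assume "p \<in> orbit Phi k \<times> orbit Phi l"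
    show "(case map_prod w' w' p of (u, v) \<Rightarrow> if u + v = m then 1 else 0)
       = (case p of (u, v) \<Rightarrow> if u + v = w m then 1 else (0::int))"
      using linear_add[OF weyl_linear[OF w'(1)]] w' by (auto simp: split_def) metis+
  qed (auto simp: w' weyl_orbit_iff[OF w] weyl_orbit_iff[OF w'(1)])
qed

text \<open>Chevalley's theorem is needed only in this weak form: invariants are integer constants
  modulo the ideal of the \<open>rho_j\<close>. No polynomial expression in the generators has to be
  produced.\<close>

definition const_mod :: "'n grp_ring set \<Rightarrow> 'n grp_ring set" where
  "const_mod J = {p. \<exists>c::int. p - of_int c \<in> J}"

text \<open>An invariant is constant on orbits, so subtracting a multiple of one orbit sum removes
  that whole orbit from the support.\<close>

lemma W_invariant_const_mod:
  assumes J: "csubring.ideal (group_ring_on La) J"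
    and "W_invariant Phi q" "\<And>k. k \<in> Poly_Mapping.keys q \<Longrightarrow> rho Phi k \<in> const_mod J"
  shows "q \<in> const_mod J"
  using assms(2,3)
proof (induction "card (Poly_Mapping.keys q)" arbitrary: q rule: less_induct)
  case less
  interpret R: csubring "group_ring_on La" by (rule csubring_La)
  show ?case
  proof (cases "q = 0")
    case True
    then show ?thesis using R.ideal_zero[OF J] by (auto simp: const_mod_def intro!: exI[of _ 0])
  next
    case False
    then obtain k where k: "k \<in> Poly_Mapping.keys q" by fastforce
    define c where "c = Poly_Mapping.lookup q k"
    define q' where "q' = q - of_int c * rho Phi k"
    have orb: "Poly_Mapping.lookup q m = c" if "m \<in> orbit Phi k" for m
      using that less.prems(1) unfolding W_invariant_def orbit_def c_def by auto
    have look: "Poly_Mapping.lookup q' m = (if m \<in> orbit Phi k then 0 else Poly_Mapping.lookup q m)" for m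
      using orb by (simp add: q'_def lookup_minus grp_ring_of_int_mult lookup_rho)
    have inv: "W_invariant Phi q'"
      using less.prems(1) by (simp add: W_invariant_def look weyl_orbit_iff)
    have sub: "Poly_Mapping.keys q' \<subseteq> Poly_Mapping.keys q" by (auto simp: in_keys_iff look split: if_splits)
    moreover have "k \<notin> Poly_Mapping.keys q'" using orbit_self[of k Phi] by (simp add: in_keys_iff look)
    ultimately have "card (Poly_Mapping.keys q') < card (Poly_Mapping.keys q)"
      using k by (intro psubset_card_mono) auto
    then have "q' \<in> const_mod J" using less.hyps[of q'] inv sub less.prems(2) by blast
    then obtain e where e: "q' - of_int e \<in> J" by (auto simp: const_mod_def)
    obtain f where f: "rho Phi k - of_int f \<in> J" using less.prems(2)[OF k] by (auto simp: const_mod_def)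
    have "(q' - of_int e) + of_int c * (rho Phi k - of_int f) \<in> J"
      using R.ideal_add[OF J e R.ideal_mult[OF J R.of_int_mem f]] .
    moreover have "(q' - of_int e) + of_int c * (rho Phi k - of_int f) = q - of_int (e + c * f)"
      by (simp add: q'_def algebra_simps)
    ultimately show ?thesis unfolding const_mod_def by (intro CollectI exI[of _ "e + c * f"]) simp
  qed
qed

text \<open>Chevalley's theorem on exponential invariants: the leading term of
  \<open>rho (l - om i) * rho (om i)\<close> is \<open>rho l\<close>, and all other terms are smaller for \<open>Bf\<close>.\<close>
lemma rho_const_mod:
  assumes J: "csubring.ideal (group_ring_on La) J" and gen: "\<And>i. i \<in> {1..n} \<Longrightarrow> rho_j Phi om i \<in> J"
    and "l \<in> La"
  shows "rho Phi l \<in> const_mod J"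
  using assms(3)
proof (induction "nat \<lfloor>Bf l l\<rfloor>" arbitrary: l rule: less_induct)
  case less
  interpret R: csubring "group_ring_on La" by (rule csubring_La)
  obtain k where k: "k \<in> orbit Phi l" "dom k" using ex_dom by blast
  have kLa: "k \<in> La" using La_orbit less.prems k by blast
  have Bk: "Bf k k = Bf l l" using Bf_orbit k by blast
  have IH: "rho Phi m \<in> const_mod J" if "m \<in> La" "Bf m m < Bf k k" for m
    using less.hyps[of m] Bf_nat_less[OF that(1) less.prems] that Bk by simp
  have "rho Phi k \<in> const_mod J"
  proof (cases "k = 0")
    case True
    have "w 0 = 0" if "w \<in> weyl_group Phi" for w using linear_0[OF weyl_linear[OF that]] .
    then have "orbit Phi 0 \<subseteq> {0}" unfolding orbit_def by auto
    then have "orbit Phi 0 = {0}" using orbit_self[of 0 Phi] by blast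
    then have "rho Phi k = 1" using True by (simp add: rho_def)
    then show ?thesis using R.ideal_zero[OF J] by (auto simp: const_mod_def intro!: exI[of _ 1])
  next
    case False
    then obtain i where i: "i \<in> {1..n}" "k \<bullet> al i \<noteq> 0" using inner_al_zero by blast
    then have ki: "0 < pr k (al i)" using k(2) al_pos[OF i(1)] by (auto simp: dom_def pr_def less_le)
    have "pr k (al i) \<in> \<int>" using kLa al_mem[OF i(1)] by (simp add: La_iff)
    then have ki1: "1 \<le> pr k (al i)" using ki by (auto elim!: Ints_cases)
    \<comment> \<open>Integrality gives \<open>pr k (al i) \<ge> 1\<close>, so lowering this
      coordinate by 1 keeps \<open>k'\<close> dominant.\<close>
    define k' where "k' = k - om i"
    have kk: "k = k' + om i" by (simp add: k'_def)
    have omdom: "dom (om i)" using i(1) om_al al_pos by (auto simp: dom_def)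
    have k'dom: "dom k'"
      unfolding dom_def
    proof
      fix j assume j: "j \<in> {1..n}"
      show "0 \<le> k' \<bullet> al j"
      proof (cases "j = i")
        case True
        have "al i \<bullet> al i \<le> 2 * (k \<bullet> al i)" using ki1 al_pos[OF i(1)] by (simp add: pr_def field_simps)
        then show ?thesis using True om_al[OF i(1) i(1)] by (simp add: k'_def inner_diff_left)
      next
        case False
        then show ?thesis using k(2) j om_al[OF i(1) j] by (simp add: k'_def inner_diff_left dom_def)
      qed
    qed
    have k'La: "k' \<in> La" unfolding k'_def using La_add[OF kLa La_uminus[OF om_La[OF i(1)]]] by simp
    have "om i \<noteq> 0" using om_al[OF i(1) i(1)] al_pos[OF i(1)] by auto
    then have "Bf k' k' < Bf k k"
      using Bf_pos[of "om i"] Bf_dom_dom[OF k'dom omdom]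
      by (simp add: kk Bf_square_add)
    then obtain c where c: "rho Phi k' - of_int c \<in> J" using IH[OF k'La] by (auto simp: const_mod_def)
    define Q where "Q = rho Phi k' * rho Phi (om i)"
    have Qinv: "W_invariant Phi Q" unfolding Q_def by (rule W_invariant_rho_mult)
    have Qk: "Poly_Mapping.lookup Q k = 1"
    proof -
      \<comment> \<open>Both \<open>k' - u\<close> and \<open>om i - v\<close> are in the cone and
        they add up to 0, so both vanish. Thus \<open>k\<close> arises from a single pair and has
        coefficient 1.\<close>
      have "u = k' \<and> v = om i" if uv: "u \<in> orbit Phi k'" "v \<in> orbit Phi (om i)" "u + v = k" for u v
      proof -
        have "cone (k' - u)" "cone (om i - v)" using dom_orbit_cone uv k'dom omdom by blast+
        moreover have "om i - v = - (k' - u)" using uv(3) unfolding kk by (simp add: algebra_simps)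
        ultimately have "k' - u = 0" using cone_antisym by metis
        then show ?thesis using uv(3) kk by simp
      qed
      then have "Poly_Mapping.lookup Q k
        = (\<Sum>p\<in>orbit Phi k' \<times> orbit Phi (om i). if p = (k', om i) then 1 else 0)"
        unfolding Q_def lookup_rho_mult by (intro sum.cong refl) (auto simp: kk split: if_splits)
      then show ?thesis using finite_orbit orbit_self[of k' Phi] orbit_self[of "om i" Phi] by simp
    qed
    define q where "q = Q - rho Phi k"
    have "q \<in> const_mod J"
    proof (rule W_invariant_const_mod[OF J])
      show qinv: "W_invariant Phi q"
        using Qinv W_invariant_rho[of k] by (simp add: W_invariant_def q_def lookup_minus)
      fix m assume m: "m \<in> Poly_Mapping.keys q"
      \<comment> \<open>The coefficient 1 at \<open>k\<close> is cancelled by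
        \<open>rho Phi k\<close>, and by invariance the whole orbit of \<open>k\<close>
        disappears.\<close>
      have mk: "m \<notin> orbit Phi k"
      proof
        assume "m \<in> orbit Phi k"
        then have "Poly_Mapping.lookup q m = Poly_Mapping.lookup q k"
          using qinv unfolding W_invariant_def orbit_def by auto
        also have "\<dots> = 0" using Qk orbit_self[of k Phi] by (simp add: q_def lookup_minus lookup_rho)
        finally show False using m by (simp add: in_keys_iff)
      qed
      then have "m \<in> Poly_Mapping.keys Q" using m by (simp add: q_def in_keys_iff lookup_minus lookup_rho)
      then obtain u v where uv: "u \<in> orbit Phi k'" "v \<in> orbit Phi (om i)" "m = u + v"
        using keys_mult[of "rho Phi k'" "rho Phi (om i)"] unfolding Q_def keys_rho by blast
      have mLa: "m \<in> La" unfolding uv(3) using La_add La_orbit k'La om_La[OF i(1)] uv by blast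
      \<comment> \<open>The comparison is made at the dominant representative of \<open>m\<close>,
        which lies strictly below \<open>k\<close>.\<close>
      obtain m' where m': "m' \<in> orbit Phi m" "dom m'" using ex_dom by blast
      obtain w where w: "w \<in> weyl_group Phi" "m' = w m" using m'(1) unfolding orbit_def by blast
      have "m' = w u + w v" using w uv(3) linear_add[OF weyl_linear[OF w(1)]] by simp
      then have "k - m' = (k' - w u) + (om i - w v)" by (simp add: kk)
      moreover have "cone (k' - w u)" "cone (om i - w v)"
        using dom_orbit_cone orbit_weyl[OF _ w(1)] uv k'dom omdom by blast+
      ultimately have "cone (k - m')" using cone_add by simp
      moreover have "k \<noteq> m'" using m'(1) mk orbit_self orbit_eq by metis
      ultimately have "Bf m' m' < Bf k k" using Bf_less m'(2) by blast
      then have "Bf m m < Bf k k" using Bf_orbit[OF m'(1)] by simp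
      then show "rho Phi m \<in> const_mod J" using IH mLa by blast
    qed
    then obtain e where e: "q - of_int e \<in> J" by (auto simp: const_mod_def)
    \<comment> \<open>With \<open>Q = q + rho Phi k\<close>, solving for \<open>rho Phi k\<close>
      leaves the three congruences known for \<open>rho Phi (om i)\<close>,
      \<open>rho Phi k'\<close> and \<open>q\<close>.\<close>
    define s where "s = s_orb Phi om i"
    have "rho Phi k' * (rho Phi (om i) - of_int s) \<in> J"
      using R.ideal_mult[OF J rho_La[OF k'La] gen[OF i(1)]] by (simp add: rho_j_def s_def)
    then have "rho Phi k' * (rho Phi (om i) - of_int s) + of_int s * (rho Phi k' - of_int c) - (q - of_int e) \<in> J"
      using R.ideal_add[OF J] R.ideal_diff[OF J] R.ideal_mult[OF J R.of_int_mem c] e by blast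
    moreover have "rho Phi k' * (rho Phi (om i) - of_int s) + of_int s * (rho Phi k' - of_int c) - (q - of_int e)
      = rho Phi k - of_int (s * c - e)" by (simp add: q_def Q_def algebra_simps)
    ultimately show ?thesis unfolding const_mod_def by (intro CollectI exI[of _ "s * c - e"]) simp
  qed
  then show ?case using rho_orbit[OF k(1)] by simp
qed

lemma rho_j_La: "i \<in> {1..n} \<Longrightarrow> rho_j Phi om i \<in> group_ring_on La"
  using csubring.diff_mem[OF csubring_La rho_La[OF om_La] csubring.of_int_mem[OF csubring_La]]
  by (simp add: rho_j_def)

lemma augmentation_rho_j: "augmentation (rho_j Phi om i) = 0"
  unfolding rho_j_def augmentation_diff augmentation_of_int augmentation_rho by (simp add: s_orb_def)

text \<open>An invariant is congruent to a constant modulo the ideal of the \<open>rho_j\<close>.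
  That ideal has augmentation 0, which forces the constant to be 0 when the invariant has
  augmentation 0.\<close>

lemma I_sc_eq: "I_sc Phi = ideal_span (group_ring_on La) (rho_j Phi om ` {1..n})"
proof
  interpret R: csubring "group_ring_on La" by (rule csubring_La)
  define J where "J = ideal_span (group_ring_on La) (rho_j Phi om ` {1..n})"
  have J: "R.ideal J" unfolding J_def by (rule R.ideal_ideal_span)
  have gen: "rho_j Phi om i \<in> J" if "i \<in> {1..n}" for i
    unfolding J_def using R.ideal_span_superset that by blast
  have aug: "augmentation p = 0" if "p \<in> J" for p
  proof -
    have "R.ideal {p. augmentation p = 0}"
      unfolding R.ideal_def by (simp add: augmentation_add augmentation_mult)
    then have "J \<subseteq> {p. augmentation p = 0}"
      unfolding J_def by (rule R.ideal_span_subset) (auto simp: augmentation_rho_j)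
    then show ?thesis using that by blast
  qed
  have "p \<in> J" if p: "p \<in> group_ring_on La" "W_invariant Phi p" "augmentation p = 0" for p
  proof -
    have "p \<in> const_mod J"
    proof (rule W_invariant_const_mod[OF J p(2)])
      show "rho Phi k \<in> const_mod J" if "k \<in> Poly_Mapping.keys p" for k
        using p(1) that by (intro rho_const_mod[OF J gen]) (auto simp: group_ring_on_def)
    qed
    then obtain c where c: "p - of_int c \<in> J" by (auto simp: const_mod_def)
    then have "c = 0" using aug[OF c] p(3) by (simp add: augmentation_diff)
    then show ?thesis using c by simp
  qed
  then show "I_sc Phi \<subseteq> ideal_span (group_ring_on La) (rho_j Phi om ` {1..n})"
    unfolding I_sc_def J_def[symmetric] by (intro R.ideal_span_subset[OF J]) blast
  show "ideal_span (group_ring_on La) (rho_j Phi om ` {1..n}) \<subseteq> I_sc Phi"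
  proof (rule R.ideal_span_subset)
    show "R.ideal (I_sc Phi)" unfolding I_sc_def by (rule R.ideal_ideal_span)
    have "W_invariant Phi (rho_j Phi om i)" for i
    proof -
      have "w l = 0 \<longleftrightarrow> l = 0" if "w \<in> weyl_group Phi" for w l
        using weyl_inv[OF that] linear_0[OF weyl_linear] that by metis
      then show ?thesis using W_invariant_rho[of "om i"]
        by (simp add: W_invariant_def rho_j_def lookup_minus lookup_of_int when_def)
    qed
    then have "rho_j Phi om ` {1..n} \<subseteq> {p \<in> group_ring_on La. W_invariant Phi p \<and> augmentation p = 0}"
      using rho_j_La augmentation_rho_j by blast
    then show "rho_j Phi om ` {1..n} \<subseteq> I_sc Phi"
      unfolding I_sc_def using R.ideal_span_superset by blast
  qed
qed

end

section \<open>The even part of the invariant ideal\<close>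

locale index2_sys = root_sys Phi n al om
  for Phi :: "(real^'n) set" and n al om +
  fixes T :: "(real^'n) set" and np :: nat and a :: "nat \<Rightarrow> nat \<Rightarrow> int" and l0 :: "real^'n"
  assumes T_idx2: "index2_subgroup T (weight_lattice Phi)"
    and T_roots: "Phi \<subseteq> T"
    and np_le: "np \<le> n"
    and reindex: "\<forall>i\<in>{1..n}. om i \<notin> T \<longleftrightarrow> i \<le> np"
    and a_coeffs: "\<forall>i\<in>{1..np}. d_gcd Phi om np i = (\<Sum>j=i..np. a i j * s_orb Phi om j)"
    and l0_odd: "l0 \<in> weight_lattice Phi - T"
begin

lemma T_La: "u \<in> T \<Longrightarrow> u \<in> La" and T_zero: "0 \<in> T"
  and T_add: "u \<in> T \<Longrightarrow> v \<in> T \<Longrightarrow> u + v \<in> T" and T_uminus: "u \<in> T \<Longrightarrow> - u \<in> T"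
  using T_idx2 unfolding index2_subgroup_def by auto

lemma T_diff: "u \<in> T \<Longrightarrow> v \<in> T \<Longrightarrow> u - v \<in> T"
  using T_add[of u "- v"] T_uminus by simp

text \<open>There are only two cosets, and neither \<open>v\<close> nor \<open>l0\<close> lies in
  \<open>T\<close>, so they share the other one.\<close>

lemma odd_coset: "v \<in> La \<Longrightarrow> v \<notin> T \<Longrightarrow> v - l0 \<in> T"
proof -
  assume v: "v \<in> La" "v \<notin> T"
  let ?C = "{(+) l ` T | l. l \<in> La}"
  have self: "u \<in> (+) u ` T" for u using T_zero by force
  have "card ?C = 2" using T_idx2 unfolding index2_subgroup_def by blast
  then obtain X Y where XY: "?C = {X, Y}" by (auto simp: card_2_iff)
  have "(+) 0 ` T = T" by simp
  then have "T \<in> ?C" using La_zero by blast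
  moreover have "(+) v ` T \<in> ?C" "(+) l0 ` T \<in> ?C" using v l0_odd by blast+
  moreover have "(+) v ` T \<noteq> T" "(+) l0 ` T \<noteq> T" using self[of v] self[of l0] v l0_odd by auto
  ultimately have "(+) v ` T = (+) l0 ` T" unfolding XY by auto
  then have "v \<in> (+) l0 ` T" using self[of v] by simp
  then show ?thesis by auto
qed

lemma odd_diff: "u \<in> La \<Longrightarrow> u \<notin> T \<Longrightarrow> v \<in> La \<Longrightarrow> v \<notin> T \<Longrightarrow> u - v \<in> T"
  using T_diff[OF odd_coset odd_coset, of u v] by simp

lemma add_T_iff: "u \<in> La \<Longrightarrow> v \<in> T \<Longrightarrow> u + v \<in> T \<longleftrightarrow> u \<in> T"
  using T_add[of u v] T_diff[of "u + v" v] by auto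

lemma add_odd_iff: "u \<in> La \<Longrightarrow> v \<in> La \<Longrightarrow> v \<notin> T \<Longrightarrow> u + v \<in> T \<longleftrightarrow> u \<notin> T"
proof -
  assume u: "u \<in> La" and v: "v \<in> La" "v \<notin> T"
  have "- v \<notin> T" using T_uminus[of "- v"] v by auto
  then have "u \<notin> T \<Longrightarrow> u - - v \<in> T" using odd_diff u v La_uminus by blast
  moreover have "u \<in> T \<Longrightarrow> u + v \<notin> T" using T_diff[of "u + v" u] v by auto
  ultimately show ?thesis by auto
qed

lemma T_int_scale: "u \<in> T \<Longrightarrow> of_int k *\<^sub>R u \<in> T"
proof -
  assume u: "u \<in> T"
  have nat: "real m *\<^sub>R u \<in> T" for m
    by (induction m) (use T_zero u in \<open>auto simp: scaleR_add_left intro: T_add\<close>)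
  show ?thesis
  proof (cases k rule: int_diff_cases)
    case (diff m m')
    then show ?thesis using T_diff[OF nat[of m] nat[of m']] by (simp add: scaleR_diff_left)
  qed
qed

text \<open>A reflection moves a weight by an integer multiple of a root, and \<open>T\<close>
  contains the roots. Hence every orbit sum is homogeneous for the parity.\<close>

lemma orbit_diff_T: "v \<in> La \<Longrightarrow> m \<in> orbit Phi v \<Longrightarrow> m - v \<in> T"
proof -
  assume v: "v \<in> La"
  have "w v \<in> La \<and> w v - v \<in> T" if "w \<in> weyl_group Phi" for w
    using that
  proof (induction rule: weyl_group.induct)
    case id
    show ?case using v T_zero by simp
  next
    case (step w b)
    then have wv: "w v \<in> La" "w v - v \<in> T" by auto
    then obtain k where k: "pr (w v) b = of_int k" using step.hyps(2) unfolding La_iff by (blast elim: Ints_cases)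
    have "refl_root b (w v) - v = (w v - v) - of_int k *\<^sub>R b"
      unfolding k[symmetric] by (simp add: refl_root_def pr_def)
    then show ?case
      using La_refl[OF step.hyps(2) wv(1)] T_diff[OF wv(2) T_int_scale[of b k]] step.hyps(2) T_roots
      unfolding comp_def by (metis subsetD)
  qed
  then show "m \<in> orbit Phi v \<Longrightarrow> m - v \<in> T" unfolding orbit_def by blast
qed

section \<open>The Z/2-grading of the group ring\<close>

abbreviation "R \<equiv> group_ring_on La"
abbreviation "R0 \<equiv> group_ring_on T"
abbreviation "R1 \<equiv> group_ring_on (La - T)"

sublocale R: csubring R by (rule csubring_La)
sublocale R0: csubring R0 by (rule csubring_group_ring[OF T_zero T_add])

lemma R0_R: "p \<in> R0 \<Longrightarrow> p \<in> R" and R1_R: "p \<in> R1 \<Longrightarrow> p \<in> R"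
  using T_La by (auto simp: group_ring_on_def)

lemma R1_add: "p \<in> R1 \<Longrightarrow> q \<in> R1 \<Longrightarrow> p + q \<in> R1"
  using Poly_Mapping.keys_add[of p q] by (auto simp: group_ring_on_def)

lemma R1_zero: "0 \<in> R1" by (simp add: group_ring_on_def)

lemma R0_R1_mult: "p \<in> R0 \<Longrightarrow> q \<in> R1 \<Longrightarrow> p * q \<in> R1"
proof -
  assume p: "p \<in> R0" and q: "q \<in> R1"
  have "k \<in> La - T" if "k \<in> Poly_Mapping.keys (p * q)" for k
  proof -
    obtain b c where "k = b + c" "b \<in> T" "c \<in> La" "c \<notin> T"
      using keys_mult[of p q] p q \<open>k \<in> _\<close> unfolding group_ring_on_def by blast
    then show ?thesis using add_odd_iff[of b c] T_La La_add by auto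
  qed
  then show ?thesis by (auto simp: group_ring_on_def)
qed

lemma R1_R1_mult: "p \<in> R1 \<Longrightarrow> q \<in> R1 \<Longrightarrow> p * q \<in> R0"
proof -
  assume p: "p \<in> R1" and q: "q \<in> R1"
  have "k \<in> T" if "k \<in> Poly_Mapping.keys (p * q)" for k
  proof -
    obtain b c where "k = b + c" "b \<in> La" "b \<notin> T" "c \<in> La" "c \<notin> T"
      using keys_mult[of p q] p q \<open>k \<in> _\<close> unfolding group_ring_on_def by blast
    then show ?thesis using add_odd_iff[of b c] by auto
  qed
  then show ?thesis by (auto simp: group_ring_on_def)
qed

lemma R1_diff: "p \<in> R1 \<Longrightarrow> q \<in> R1 \<Longrightarrow> p - q \<in> R1"
  using R1_add[of p "(-1) * q"] R0_R1_mult[of "-1" q] by auto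

lemma R1_sum: "(\<And>i. i \<in> I \<Longrightarrow> f i \<in> R1) \<Longrightarrow> sum f I \<in> R1"
  by (induction I rule: infinite_finite_induct) (auto simp: R1_zero R1_add)

definition ev :: "'n grp_ring \<Rightarrow> 'n grp_ring" where "ev = restr T"
definition od :: "'n grp_ring \<Rightarrow> 'n grp_ring" where "od = restr (- T)"

lemma ev_R0: "p \<in> R \<Longrightarrow> ev p \<in> R0" and od_R1: "p \<in> R \<Longrightarrow> od p \<in> R1"
  by (auto simp: group_ring_on_def ev_def od_def keys_restr)

lemma ev_mult_even: "p \<in> R \<Longrightarrow> q \<in> R0 \<Longrightarrow> ev (p * q) = ev p * q"
  and od_mult_even: "p \<in> R \<Longrightarrow> q \<in> R0 \<Longrightarrow> od (p * q) = od p * q"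
  unfolding ev_def od_def group_ring_on_def by (auto intro!: restr_mult simp: add_T_iff subset_iff)

lemma ev_mult_odd: "p \<in> R \<Longrightarrow> q \<in> R1 \<Longrightarrow> ev (p * q) = od p * q"
  and od_mult_odd: "p \<in> R \<Longrightarrow> q \<in> R1 \<Longrightarrow> od (p * q) = ev p * q"
  unfolding ev_def od_def group_ring_on_def by (auto intro!: restr_mult simp: add_odd_iff subset_iff)

lemma ev_add: "ev (p + q) = ev p + ev q" and od_add: "od (p + q) = od p + od q"
  and ev_diff: "ev (p - q) = ev p - ev q" and od_diff: "od (p - q) = od p - od q"
  and ev_sum: "ev (sum f I) = (\<Sum>i\<in>I. ev (f i))" and od_sum: "od (sum f I) = (\<Sum>i\<in>I. od (f i))"
  for f :: "nat \<Rightarrow> 'n grp_ring"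
  by (simp_all add: ev_def od_def restr_add restr_diff restr_sum)

lemma ev_id: "p \<in> R0 \<Longrightarrow> ev p = p" and od_zero: "p \<in> R0 \<Longrightarrow> od p = 0"
  by (auto simp: ev_def od_def group_ring_on_def intro: restr_id restr_empty)

section \<open>Parity of the orbit sums and divisibility of their sizes\<close>

abbreviation "s \<equiv> s_orb Phi om"
abbreviation "q \<equiv> rho_j Phi om"
abbreviation "y i \<equiv> rho Phi (om i)"
abbreviation "dg \<equiv> d_gcd Phi om np"
abbreviation "yt \<equiv> rho_tilde_om Phi om np a"

lemma qy: "q i = y i - of_int (s i)"
  by (simp add: rho_j_def)

lemma s_pos: "0 < s i"
  using finite_orbit[of "om i"] orbit_self[of "om i" Phi] by (auto simp: s_orb_def card_gt_0_iff)

lemma y_odd: "i \<in> {1..np} \<Longrightarrow> y i \<in> R1"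
proof -
  assume i: "i \<in> {1..np}"
  then have i': "i \<in> {1..n}" using np_le by auto
  then have om: "om i \<in> La" "om i \<notin> T" using om_La reindex i by auto
  have "m \<notin> T" if "m \<in> orbit Phi (om i)" for m
    using orbit_diff_T[OF om(1) that] T_diff[of m "m - om i"] om by auto
  then show ?thesis using La_orbit[OF om(1)] by (auto simp: group_ring_on_def keys_rho)
qed

lemma q_even: "i \<in> {1..n} \<Longrightarrow> np < i \<Longrightarrow> q i \<in> R0"
proof -
  assume i: "i \<in> {1..n}" "np < i"
  then have om: "om i \<in> La" "om i \<in> T" using om_La reindex by (blast, force)
  have "m \<in> T" if "m \<in> orbit Phi (om i)" for m
    using T_add[OF orbit_diff_T[OF om(1) that] om(2)] by simp
  then have "y i \<in> R0" by (auto simp: group_ring_on_def keys_rho)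
  then show ?thesis by (simp add: qy)
qed

text \<open>\<open>l0\<close> is an integer combination of the fundamental weights; if all of them
  were in \<open>T\<close>, it would be too.\<close>

lemma np_pos: "1 \<le> np"
proof (rule ccontr)
  assume "\<not> 1 \<le> np"
  then have om: "om i \<in> T" if "i \<in> {1..n}" for i using reindex that by auto
  have "(2 * (l0 \<bullet> al j) / (al j \<bullet> al j)) *\<^sub>R om j \<in> T" if j: "j \<in> {1..n}" for j
  proof -
    obtain k where "2 * (l0 \<bullet> al j) / (al j \<bullet> al j) = of_int k"
      using l0_odd al_mem[OF j] unfolding weight_lattice_def by (blast elim: Ints_cases)
    then show ?thesis using T_int_scale[OF om[OF j]] by simp
  qed
  then have "(\<Sum>j\<in>I. (2 * (l0 \<bullet> al j) / (al j \<bullet> al j)) *\<^sub>R om j) \<in> T" if "I \<subseteq> {1..n}" for I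
    using that by (induction I rule: infinite_finite_induct) (auto simp: T_zero intro!: T_add)
  then have "l0 \<in> T" by (subst om_expansion) blast
  then show False using l0_odd by blast
qed

lemma yt_eq: "i \<in> {1..np} \<Longrightarrow> yt i = (\<Sum>j=i..np. of_int (a i j) * y j)"
proof -
  assume i: "i \<in> {1..np}"
  have "yt i = (\<Sum>j=i..np. of_int (a i j) * y j) - of_int (\<Sum>j=i..np. a i j * s j) + of_int (dg i)"
    by (simp add: rho_tilde_om_def qy algebra_simps sum_subtractf)
  then show ?thesis using a_coeffs i by simp
qed

lemma dg_dvd: "i \<le> j \<Longrightarrow> j \<le> np \<Longrightarrow> dg i dvd s j"
  by (simp add: d_gcd_def)

lemma dg_pos: "i \<le> np \<Longrightarrow> 0 < dg i"
proof -
  assume "i \<le> np"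
  then have "dg i dvd s np" by (rule dg_dvd) simp
  then have "dg i \<noteq> 0" using s_pos[of np] by auto
  moreover have "0 \<le> dg i" by (simp add: d_gcd_def)
  ultimately show ?thesis by simp
qed

section \<open>The ideal of the proposed generators\<close>

definition hs :: "'n grp_ring set" where
  "hs = {h1 Phi om np a l0 i | i. 1 \<le> i \<and> i < np} \<union> {h2 Phi om np a i | i. 1 \<le> i \<and> i \<le> np}
    \<union> {h3 Phi om i | i. np < i \<and> i \<le> n}"

abbreviation "H \<equiv> ideal_span R0 hs"

lemma H_ideal: "R0.ideal H" by (rule R0.ideal_ideal_span)
lemma hs_H: "h \<in> hs \<Longrightarrow> h \<in> H" using R0.ideal_span_superset by blast

text \<open>The \<open>h1\<close> span the lattice of relations \<open>\<Sum>j. c j * s j = 0\<close>: since \<open>c i * s i\<close> is divisible by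
  \<open>dg (i + 1)\<close>, a multiple of \<open>h1 i\<close> removes the first term.\<close>
lemma relation_mem_H:
  assumes "i \<in> {1..np}" "(\<Sum>j=i..np. c j * s j) = 0"
  shows "ex l0 * (\<Sum>j=i..np. of_int (c j) * y j) \<in> H"
  using assms
proof (induction "np - i" arbitrary: i c)
  case 0
  then have i: "i = np" by auto
  then have "c i = 0" using 0 s_pos[of i] by auto
  then show ?case using i R0.ideal_zero[OF H_ideal] by simp
next
  case (Suc k)
  then have i: "i \<in> {1..np}" "i < np" by auto
  define r where "r = lcm (s i) (dg (i + 1))"
  have split: "{i..np} = insert i {i + 1..np}" using i by auto
  have sum_split: "(\<Sum>j=i..np. f j) = f i + (\<Sum>j=i + 1..np. f j)" for f :: "nat \<Rightarrow> 'b::comm_monoid_add"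
    unfolding split by simp
  have "dg (i + 1) dvd (\<Sum>j=i + 1..np. c j * s j)"
    using dg_dvd[of "i + 1"] by (intro dvd_sum) auto
  moreover have ci: "c i * s i = - (\<Sum>j=i + 1..np. c j * s j)"
    using Suc.prems(2) unfolding sum_split[of "\<lambda>j. c j * s j"] by simp
  ultimately have "dg (i + 1) dvd c i * s i" by simp
  then have "r dvd c i * s i" unfolding r_def by (intro lcm_least) auto
  then obtain t where t: "c i * s i = r * t" by blast
  define u where "u = r div s i"
  define v where "v = r div dg (i + 1)"
  have u: "r = u * s i" and v: "r = v * dg (i + 1)" unfolding u_def v_def r_def by auto
  have cu: "c i = u * t" using t s_pos[of i] unfolding u by auto
  \<comment> \<open>Subtracting \<open>t\<close> times \<open>h1 i\<close> spills
    \<open>t * v * a (i + 1) j\<close> into the remaining coefficients. They still form a relation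
    because \<open>v * dg (i + 1) = r\<close> and \<open>t * r = c i * s i\<close>.\<close>
  define c' where "c' j = c j + t * v * a (i + 1) j" for j
  have i1: "i + 1 \<in> {1..np}" using i by auto
  have dg1: "dg (i + 1) = (\<Sum>j=i + 1..np. a (i + 1) j * s j)" using a_coeffs i1 by blast
  have "(\<Sum>j=i + 1..np. c' j * s j) = (\<Sum>j=i + 1..np. c j * s j) + t * v * dg (i + 1)"
    unfolding c'_def dg1 by (simp add: algebra_simps sum.distrib sum_distrib_left)
  also have "\<dots> = - (c i * s i) + t * r" using ci v by simp
  also have "\<dots> = 0" using t by simp
  finally have "ex l0 * (\<Sum>j=i + 1..np. of_int (c' j) * y j) \<in> H"
    using Suc.hyps(1)[of "i + 1" c'] Suc.hyps(2) i1 by simp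
  moreover have "h1 Phi om np a l0 i \<in> H" using i by (intro hs_H) (auto simp: hs_def)
  then have "of_int t * h1 Phi om np a l0 i \<in> H" using R0.ideal_mult[OF H_ideal R0.of_int_mem] by blast
  ultimately have "of_int t * h1 Phi om np a l0 i + ex l0 * (\<Sum>j=i + 1..np. of_int (c' j) * y j) \<in> H"
    by (intro R0.ideal_add[OF H_ideal])
  moreover have "of_int t * h1 Phi om np a l0 i + ex l0 * (\<Sum>j=i + 1..np. of_int (c' j) * y j)
    = ex l0 * (\<Sum>j=i..np. of_int (c j) * y j)"
  proof -
    have h: "h1 Phi om np a l0 i = ex l0 * (of_int u * y i - of_int v * yt (i + 1))"
      unfolding h1_def Let_def u_def v_def r_def ..
    have c'_sum: "(\<Sum>j=i + 1..np. of_int (c' j) * y j)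
        = (\<Sum>j=i + 1..np. of_int (c j) * y j) + of_int t * of_int v * yt (i + 1)"
      unfolding c'_def yt_eq[OF i1] by (simp add: algebra_simps sum.distrib sum_distrib_left)
    show ?thesis
      unfolding sum_split[of "\<lambda>j. of_int (c j) * y j"] cu h c'_sum by (simp add: algebra_simps)
  qed
  ultimately show ?case by simp
qed

definition d where "d = dg 1"
definition y1 where "y1 = yt 1"
definition sg where "sg i = (if i \<le> np then s i div d else 0)"
text \<open>Padded with 0 like \<open>sg\<close>, so that the Koszul argument runs uniformly over
  \<open>{1..n}\<close>.\<close>

definition a' where "a' i = (if i \<le> np then a 1 i else 0)"
definition Y :: "'n grp_ring" where "Y = (\<Sum>i=1..n. of_int (a' i) * q i)"
definition z :: "nat \<Rightarrow> 'n grp_ring" where "z i = q i - of_int (sg i) * Y"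
abbreviation "D \<equiv> (of_int d :: 'n grp_ring)"
text \<open>The modulus slot of \<open>partial_ideal\<close> holds the last generator here;
  \<open>D\<close> is not among the generators.\<close>

abbreviation "J \<equiv> R.partial_ideal (Y * (Y + 2 * D)) z n"

lemma sum_np: "(\<Sum>i=1..n. if i \<le> np then f i else 0) = (\<Sum>i=1..np. f i)"
  for f :: "nat \<Rightarrow> 'b::comm_monoid_add"
  using np_le by (intro sum.mono_neutral_cong_right) auto

lemma d_pos: "0 < d" using dg_pos np_pos by (simp add: d_def)

lemma sg_d: "i \<in> {1..np} \<Longrightarrow> sg i * d = s i"
  using dg_dvd[of 1 i] by (simp add: sg_def d_def)

lemma a'_sg: "(\<Sum>i=1..n. a' i * sg i) = 1"
proof -
  have "(\<Sum>i=1..n. a' i * sg i) = (\<Sum>i=1..n. if i \<le> np then a 1 i * sg i else 0)"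
    by (intro sum.cong) (auto simp: a'_def)
  then have "(\<Sum>i=1..n. a' i * sg i) * d = (\<Sum>i=1..np. a 1 i * sg i) * d" by (simp only: sum_np)
  also have "\<dots> = (\<Sum>i=1..np. a 1 i * s i)"
    unfolding sum_distrib_right using sg_d by (intro sum.cong refl) (simp add: mult.assoc)
  also have "\<dots> = d" using a_coeffs np_pos by (simp add: d_def)
  finally show ?thesis using d_pos by simp
qed

lemma y1: "y1 = Y + D"
proof -
  have "Y = (\<Sum>i=1..n. if i \<le> np then of_int (a 1 i) * q i else 0)"
    unfolding Y_def by (intro sum.cong) (auto simp: a'_def)
  then show ?thesis unfolding sum_np by (simp add: y1_def rho_tilde_om_def d_def)
qed

lemma y1_eq: "y1 = (\<Sum>j=1..np. of_int (a 1 j) * y j)"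
  unfolding y1_def using np_pos by (intro yt_eq) simp

lemma h2_eq: "h2 Phi om np a i = y i * y1 - of_int (d * s i)"
  by (simp add: h2_def y1_def d_def)

lemma y1_odd: "y1 \<in> R1"
  unfolding y1_eq using y_odd by (auto intro!: R1_sum R0_R1_mult)

text \<open>The constants \<open>s i\<close> and \<open>sg i * d\<close> cancel, which leaves a
  homogeneous element of odd degree.\<close>

lemma z_eq: "i \<in> {1..np} \<Longrightarrow> z i = y i - of_int (sg i) * y1"
  using arg_cong[OF sg_d, of i "of_int :: int \<Rightarrow> 'n grp_ring"] by (simp add: z_def qy y1 algebra_simps)

lemma z_odd: "i \<in> {1..np} \<Longrightarrow> z i \<in> R1"
  unfolding z_eq by (intro R1_diff R0_R1_mult) (auto simp: y_odd y1_odd)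

lemma z_high: "np < i \<Longrightarrow> z i = q i"
  by (simp add: z_def sg_def)

lemma q_R: "i \<in> {1..n} \<Longrightarrow> q i \<in> R"
  by (rule rho_j_La)

lemma Y2: "Y * (Y + 2 * D) = y1 * y1 - D * D"
  by (simp add: y1 algebra_simps)

lemma Y2_even: "Y * (Y + 2 * D) \<in> R0"
  unfolding Y2 using R1_R1_mult[OF y1_odd y1_odd] by auto

text \<open>The coefficients of \<open>z i\<close> in the \<open>y j\<close> form a relation among
  the orbit sizes, because \<open>sg i * d = s i\<close>. The factor \<open>ex l0\<close> moves the
  odd element \<open>z i\<close> into even degree.\<close>

lemma z_mem_H: "i \<in> {1..np} \<Longrightarrow> ex l0 * z i \<in> H"
proof -
  assume i: "i \<in> {1..np}"
  define c where "c j = (if j = i then 1 else 0) - sg i * a 1 j" for j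
  have "(\<Sum>j=1..np. c j * s j) = (\<Sum>j=1..np. if j = i then s j else 0) - sg i * (\<Sum>j=1..np. a 1 j * s j)"
    unfolding c_def sum_distrib_left sum_subtractf[symmetric] by (intro sum.cong) (auto simp: algebra_simps)
  also have "\<dots> = s i - sg i * d" using i a_coeffs np_pos by (simp add: d_def)
  finally have "(\<Sum>j=1..np. c j * s j) = 0" using sg_d[OF i] by simp
  then have "ex l0 * (\<Sum>j=1..np. of_int (c j) * y j) \<in> H" using relation_mem_H[of 1 c] np_pos by simp
  moreover have "(\<Sum>j=1..np. of_int (c j) * y j) = z i"
  proof -
    have "(\<Sum>j=1..np. of_int (c j) * y j)
        = (\<Sum>j=1..np. if j = i then y j else 0) - of_int (sg i) * (\<Sum>j=1..np. of_int (a 1 j) * y j)"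
      unfolding c_def sum_distrib_left sum_subtractf[symmetric] by (intro sum.cong) (auto simp: algebra_simps)
    also have "\<dots> = z i" using i by (simp add: z_eq y1_eq)
    finally show ?thesis .
  qed
  ultimately show ?thesis by simp
qed

text \<open>Weighting the \<open>h2 i\<close> with the Bezout coefficients turns \<open>y i\<close>
  into \<open>y1\<close> and \<open>s i\<close> into \<open>d\<close>.\<close>

lemma Y2_mem_H: "Y * (Y + 2 * D) \<in> H"
proof -
  have "(\<Sum>i=1..np. of_int (a 1 i) * h2 Phi om np a i) \<in> H"
    by (intro R0.ideal_sum[OF H_ideal] R0.ideal_mult[OF H_ideal] hs_H) (auto simp: hs_def)
  also have "(\<Sum>i=1..np. of_int (a 1 i) * h2 Phi om np a i)
      = (\<Sum>i=1..np. of_int (a 1 i) * y i) * y1 - D * of_int (\<Sum>i=1..np. a 1 i * s i)"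
    unfolding h2_eq of_int_sum sum_distrib_left sum_distrib_right sum_subtractf[symmetric]
    by (intro sum.cong) (auto simp: algebra_simps)
  also have "\<dots> = y1 * y1 - D * D" using a_coeffs np_pos by (simp add: y1_eq d_def)
  finally show ?thesis unfolding Y2 .
qed

text \<open>All generators of \<open>J\<close> are homogeneous, so even parts are taken term by
  term. An odd \<open>z i\<close> meets the odd part of its coefficient, and inserting
  \<open>ex (- l0) * ex l0\<close> makes both factors even.\<close>

lemma J_even_subset_H: "f \<in> J \<Longrightarrow> f \<in> R0 \<Longrightarrow> f \<in> H"
proof -
  assume "f \<in> J" and f0: "f \<in> R0"
  then obtain c v where c: "\<forall>i\<in>{1..n}. c i \<in> R" and v: "v \<in> R"
    and f: "f = (\<Sum>i=1..n. c i * z i) + Y * (Y + 2 * D) * v" unfolding R.partial_ideal_def by blast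
  have ev_term: "ev (c i * z i) \<in> H" if i: "i \<in> {1..n}" for i
  proof (cases "i \<le> np")
    case True
    then have i': "i \<in> {1..np}" using i by auto
    have e: "ex (- l0) \<in> R1" using l0_odd La_uminus[of l0] T_uminus[of "- l0"] by (auto simp: group_ring_on_def)
    have "ev (c i * z i) = od (c i) * z i" using ev_mult_odd c i z_odd[OF i'] by blast
    also have "\<dots> = (ex (- l0) * od (c i)) * (ex l0 * z i)"
      by (simp add: mult_single mult.assoc[symmetric] mult.commute[of _ "ex l0"])
    also have "\<dots> \<in> H"
      by (rule R0.ideal_mult[OF H_ideal R1_R1_mult[OF e od_R1] z_mem_H[OF i']]) (use c i in blast)
    finally show ?thesis .
  next
    case False
    then have zi: "z i = q i" "q i \<in> R0" using z_high q_even i by auto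
    have "q i \<in> H" using False i by (intro hs_H) (auto simp: hs_def h3_def)
    then show ?thesis
      using ev_mult_even[of "c i" "q i"] ev_R0 c i zi R0.ideal_mult[OF H_ideal] by simp
  qed
  have "f = ev f" using ev_id[OF f0] by simp
  also have "\<dots> = (\<Sum>i=1..n. ev (c i * z i)) + ev v * (Y * (Y + 2 * D))"
    using ev_mult_even[OF v Y2_even] by (simp add: f ev_add ev_sum mult.commute)
  also have "\<dots> \<in> H"
    using ev_term R0.ideal_mult[OF H_ideal ev_R0[OF v] Y2_mem_H]
    by (intro R0.ideal_add[OF H_ideal] R0.ideal_sum[OF H_ideal])
  finally show ?thesis .
qed

lemma z_J: "i \<in> {1..n} \<Longrightarrow> z i \<in> J"
proof -
  assume i: "i \<in> {1..n}"
  have "(\<Sum>j=1..n. (if j = i then 1 else 0) * z j) = (\<Sum>j=1..n. if j = i then z j else 0)"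
    by (intro sum.cong) auto
  also have "\<dots> = z i" using i by simp
  finally have "z i = (\<Sum>j=1..n. (if j = i then 1 else 0) * z j) + Y * (Y + 2 * D) * 0" by simp
  then show ?thesis unfolding R.partial_ideal_def
    by (intro CollectI exI[of _ "\<lambda>j. if j = i then 1 else 0"] exI[of _ 0]) auto
qed

lemma Y2_J: "Y * (Y + 2 * D) \<in> J"
  unfolding R.partial_ideal_def by (intro CollectI exI[of _ "\<lambda>_. 0"] exI[of _ 1]) auto

lemmas J_ideal = R.ideal_partial_ideal[of "Y * (Y + 2 * D)" z n]

lemma torsion_free:
  assumes K: "R.koszul_mod D {1..n} q" and w: "w \<in> R" "D * w \<in> J"
  shows "w \<in> J"
proof -
  obtain c v where c: "\<forall>i\<in>{1..n}. c i \<in> R" and v: "v \<in> R"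
    and Dw: "D * w = (\<Sum>i=1..n. c i * z i) + Y * (Y + 2 * D) * v"
    using w(2) unfolding R.partial_ideal_def by blast
  have two: "u = 0" if "u + u = (0 :: 'n grp_ring)" for u
    using grp_ring_torsion_free[of 2 u] that by (simp add: mult_2)
  have as: "(\<Sum>i=1..n. of_int (a' i) * of_int (sg i)) = (1 :: 'n grp_ring)"
    using arg_cong[OF a'_sg, of "of_int :: int \<Rightarrow> 'n grp_ring"] by simp
  obtain b g where b: "\<And>i. i \<in> {1..n} \<Longrightarrow> b i \<in> R" "g \<in> R"
    "w = (\<Sum>i=1..n. b i * z i) + g * (Y * (Y + 2 * D))"
    by (rule R.koszul_torsion_free[OF _ K, of "\<lambda>i. of_int (a' i)" "\<lambda>i. of_int (sg i)" Y z w c v])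
      (use q_R grp_ring_torsion_free[of d] d_pos two as w c v Dw in \<open>auto simp: Y_def z_def mult.commute\<close>)
  show ?thesis unfolding b(3)
    by (rule R.ideal_add[OF J_ideal R.ideal_sum[OF J_ideal] R.ideal_mult[OF J_ideal b(2) Y2_J]])
      (blast intro: R.ideal_mult[OF J_ideal] b(1) z_J)
qed

lemma I_even_subset_J:
  assumes K: "R.koszul_mod D {1..n} q" and f: "f \<in> I_sc Phi" "f \<in> R0"
  shows "f \<in> J"
proof -
  \<comment> \<open>With modulus 0, \<open>partial_ideal\<close> is just the ideal generated by the
    \<open>q i\<close>.\<close>
  have qI: "q i \<in> R.partial_ideal 0 q n" if i: "i \<in> {1..n}" for i
  proof -
    have "(\<Sum>j=1..n. (if j = i then 1 else 0) * q j) = (\<Sum>j=1..n. if j = i then q j else 0)"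
      by (intro sum.cong) auto
    also have "\<dots> = q i" using i by simp
    finally show ?thesis unfolding R.partial_ideal_def
      by (intro CollectI exI[of _ "\<lambda>j. if j = i then 1 else 0"] exI[of _ 0]) auto
  qed
  have "I_sc Phi \<subseteq> R.partial_ideal 0 q n"
    unfolding I_sc_eq using qI by (intro R.ideal_span_subset[OF R.ideal_partial_ideal]) auto
  then obtain c where c: "\<forall>i\<in>{1..n}. c i \<in> R" and fc: "f = (\<Sum>i=1..n. c i * q i)"
    using f(1) unfolding R.partial_ideal_def by auto
  define g where "g = (\<Sum>i=1..n. c i * of_int (sg i))"
  have gR: "g \<in> R" unfolding g_def using c by (intro R.sum_mem R.mult_mem) auto
  define j where "j = (\<Sum>i=1..n. c i * z i)"
  have "f = j + g * Y"
    unfolding fc j_def g_def z_def by (simp add: algebra_simps sum_subtractf sum_distrib_left)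
  then have fj: "f = j + g * y1 - g * D" by (simp add: y1 algebra_simps)
  have part: "ev (c i * z i) \<in> J \<and> od (c i * z i) \<in> J" if i: "i \<in> {1..n}" for i
  proof (cases "i \<le> np")
    case True
    then have "z i \<in> R1" using z_odd i by auto
    then show ?thesis using ev_mult_odd[of "c i" "z i"] od_mult_odd[of "c i" "z i"] c i z_J[OF i]
        R.ideal_mult[OF J_ideal] ev_R0 od_R1 R0_R R1_R by simp
  next
    case False
    then have "z i \<in> R0" using z_high q_even i by auto
    then show ?thesis using ev_mult_even[of "c i" "z i"] od_mult_even[of "c i" "z i"] c i z_J[OF i]
        R.ideal_mult[OF J_ideal] ev_R0 od_R1 R0_R R1_R by simp
  qed
  have evj: "ev j \<in> J" and odj: "od j \<in> J"
    unfolding j_def ev_sum od_sum using part by (auto intro!: R.ideal_sum[OF J_ideal])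
  have f_ev: "f = ev j + od g * y1 - ev g * D"
    using ev_id[OF f(2)] unfolding fj
    by (simp add: ev_add ev_diff ev_mult_odd[OF gR y1_odd] ev_mult_even[OF gR R0.of_int_mem])
  have "0 = od j + ev g * y1 - od g * D"
    using od_zero[OF f(2)] unfolding fj
    by (simp add: od_add od_diff od_mult_odd[OF gR y1_odd] od_mult_even[OF gR R0.of_int_mem])
  then have odd: "od g * D = od j + ev g * y1" by simp
  \<comment> \<open>\<open>w\<close> is the even part of \<open>g * (y1 - D)\<close>, so
    \<open>f = ev j + w\<close>. In \<open>D * w\<close> the odd equation replaces
    \<open>od g * D\<close>, producing \<open>y1 * od j\<close> and a multiple of
    \<open>y1 * y1 - D * D\<close>.\<close>
  define w where "w = od g * y1 - ev g * D"
  have "D * w = (od g * D) * y1 - ev g * D * D" by (simp add: w_def algebra_simps)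
  also have "\<dots> = y1 * od j + ev g * (Y * (Y + 2 * D))" unfolding odd Y2 by (simp add: algebra_simps)
  also have "\<dots> \<in> J"
    using odj Y2_J R1_R[OF y1_odd] R0_R[OF ev_R0[OF gR]]
    by (blast intro: R.ideal_add[OF J_ideal] R.ideal_mult[OF J_ideal])
  finally have "D * w \<in> J" .
  moreover have "w \<in> R"
    unfolding w_def using R1_R[OF y1_odd] R0_R[OF ev_R0[OF gR]] R1_R[OF od_R1[OF gR]] by auto
  ultimately have "w \<in> J" using torsion_free[OF K] by blast
  then have "ev j + w \<in> J" by (rule R.ideal_add[OF J_ideal evj])
  then show ?thesis unfolding w_def by (subst f_ev) (simp only: add_diff_eq)
qed

section \<open>The generators lie in the even part, and conclusion\<close>

lemma I_ideal: "R.ideal (I_sc Phi)"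
  unfolding I_sc_def by (rule R.ideal_ideal_span)

lemma q_I: "i \<in> {1..n} \<Longrightarrow> q i \<in> I_sc Phi"
  unfolding I_sc_eq using R.ideal_span_superset by blast

lemma yt_I: "i \<in> {1..np} \<Longrightarrow> yt i - of_int (dg i) \<in> I_sc Phi"
  unfolding rho_tilde_om_def using q_I np_le
  by (auto intro!: R.ideal_sum[OF I_ideal] R.ideal_mult[OF I_ideal])

lemma y1_I: "y1 - of_int d \<in> I_sc Phi"
  unfolding y1_def d_def using np_pos by (intro yt_I) simp

lemma H_subset: "H \<subseteq> I_sc Phi \<inter> R0"
proof (rule R0.ideal_span_subset)
  show "R0.ideal (I_sc Phi \<inter> R0)"
    using I_ideal R0_R unfolding R.ideal_def R0.ideal_def by auto
  have l0: "ex l0 \<in> R1" using l0_odd by (auto simp: group_ring_on_def)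
  have yt_odd: "yt i \<in> R1" if "i \<in> {1..np}" for i
    unfolding yt_eq[OF that] using y_odd that by (auto intro!: R1_sum R0_R1_mult)
  have "h1 Phi om np a l0 i \<in> I_sc Phi \<inter> R0" if i: "1 \<le> i" "i < np" for i
  proof -
    define r where "r = lcm (s i) (dg (i + 1))"
    define u where "u = r div s i"
    define v where "v = r div dg (i + 1)"
    have u: "r = u * s i" and v: "r = v * dg (i + 1)" unfolding u_def v_def r_def by auto
    have h: "h1 Phi om np a l0 i = ex l0 * (of_int u * y i - of_int v * yt (i + 1))"
      unfolding h1_def Let_def u_def v_def r_def ..
    \<comment> \<open>Both terms have augmentation \<open>r\<close>, so the constants
      cancel.\<close>
    have "of_int u * y i - of_int v * yt (i + 1) = of_int u * q i - of_int v * (yt (i + 1) - of_int (dg (i + 1)))"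
      using arg_cong[OF trans[OF u[symmetric] v], of "of_int :: int \<Rightarrow> 'n grp_ring"] by (simp add: qy algebra_simps)
    also have "\<dots> \<in> I_sc Phi"
      using i np_le by (intro R.ideal_diff[OF I_ideal] R.ideal_mult[OF I_ideal] q_I yt_I) auto
    finally have "h1 Phi om np a l0 i \<in> I_sc Phi" unfolding h by (intro R.ideal_mult[OF I_ideal] R1_R[OF l0])
    moreover have "h1 Phi om np a l0 i \<in> R0"
      unfolding h using i by (intro R1_R1_mult[OF l0] R1_diff R0_R1_mult y_odd yt_odd) auto
    ultimately show ?thesis by blast
  qed
  moreover have "h2 Phi om np a i \<in> I_sc Phi \<inter> R0" if i: "1 \<le> i" "i \<le> np" for i
  proof -
    have yi: "y i \<in> R1" "y1 \<in> R1" using y_odd y1_odd i by auto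
    have "h2 Phi om np a i = y1 * q i + of_int (s i) * (y1 - of_int d)"
      by (simp add: h2_eq qy algebra_simps)
    also have "\<dots> \<in> I_sc Phi"
      using i np_le np_pos R1_R[OF yi(2)]
      by (intro R.ideal_add[OF I_ideal] R.ideal_mult[OF I_ideal] q_I y1_I) auto
    finally have "h2 Phi om np a i \<in> I_sc Phi" .
    moreover have "h2 Phi om np a i \<in> R0" unfolding h2_eq using R1_R1_mult[OF yi] by auto
    ultimately show ?thesis by blast
  qed
  moreover have "h3 Phi om i \<in> I_sc Phi \<inter> R0" if "np < i" "i \<le> n" for i
    unfolding h3_def using q_I q_even that by auto
  ultimately show "hs \<subseteq> I_sc Phi \<inter> R0" unfolding hs_def by blast
qed

lemma H_eq:
  assumes "is_Z_basis La n x" "gen_flat La n x q"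
  shows "H = I_sc Phi \<inter> R0"
proof -
  obtain A B where AB: "\<And>i j. i \<in> {1..n} \<Longrightarrow> j \<in> {1..n} \<Longrightarrow> A i j \<in> R"
    "\<And>i j. i \<in> {1..n} \<Longrightarrow> j \<in> {1..n} \<Longrightarrow> B i j \<in> R"
    "\<And>i j. i \<in> {1..n} \<Longrightarrow> j \<in> {1..n} \<Longrightarrow> (\<Sum>k=1..n. A i k * B k j) = (if i = j then 1 else 0)"
    and flat: "flat n x (\<lambda>j. \<Sum>i=1..n. q i * A i j)"
    using assms(2) unfolding gen_flat_def invertible_over_def by blast
  \<comment> \<open>The vanishing holds for the flat tuple \<open>q A\<close> and is carried back to
    \<open>q\<close> along \<open>A\<close>.\<close>
  have "R.koszul_mod D {1..n} q"
    using flat_koszul_mod[OF assms(1) flat, of d] d_pos AB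
    by (intro R.koszul_mod_transform[of "{1..n}" D q A B]) auto
  then show ?thesis using H_subset I_even_subset_J J_even_subset_H by blast
qed

end

theorem theorem3p4:
  fixes Phi :: "(real^'n) set"
    and al om :: "nat \<Rightarrow> real^'n"
    and T :: "(real^'n) set"
    and np :: nat
    and a :: "nat \<Rightarrow> nat \<Rightarrow> int"
    and l0 :: "real^'n"
    and x :: "nat \<Rightarrow> real^'n"
  assumes rs: "root_system Phi"
    and base: "is_base Phi CARD('n) al"
    and fw: "fundamental_weights CARD('n) al om"
    and T_idx2: "index2_subgroup T (weight_lattice Phi)"
    and T_roots: "Phi \<subseteq> T"
    and np_le: "np \<le> CARD('n)"
    and reindex: "\<forall>i\<in>{1..CARD('n)}. om i \<notin> T \<longleftrightarrow> i \<le> np"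
    and a_coeffs: "\<forall>i\<in>{1..np}. d_gcd Phi om np i = (\<Sum>j=i..np. a i j * s_orb Phi om j)"
    and l0_odd: "l0 \<in> weight_lattice Phi - T"
    and x_basis: "is_Z_basis (weight_lattice Phi) CARD('n) x"
    and gflat: "gen_flat (weight_lattice Phi) CARD('n) x (rho_j Phi om)"
  shows "ideal_span (group_ring_on T)
           ({h1 Phi om np a l0 i | i. 1 \<le> i \<and> i < np}
            \<union> {h2 Phi om np a i | i. 1 \<le> i \<and> i \<le> np}
            \<union> {h3 Phi om i | i. np < i \<and> i \<le> CARD('n)})
         = I_sc Phi \<inter> group_ring_on T"
proof -
  interpret index2_sys Phi "CARD('n)" al om T np a l0
    by unfold_locales (fact rs base fw T_idx2 T_roots np_le reindex a_coeffs l0_odd)+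
  show ?thesis using H_eq[OF x_basis gflat] unfolding hs_def .
qed

end
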